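(* Let $M=\mathbb{S}^3\times\mathbb{S}^1$ (a $4$-dimensional manifold). There exists a finitely generated group $\Gamma\subset \mathrm{Diff}^\infty(M)$ such that: (1) $\Gamma$ has exponential growth of derivatives; (2) every element $g\in\Gamma$ preserves a Riemannian metric $m_g$ on $M$ (which must depend on $g$).
   Context: $\mathrm{Diff}^\infty(M)$ is the group of $C^\infty$ diffeomorphisms of the compact manifold $M$. Fix a Riemannian metric on $M$. For $g\in\mathrm{Diff}^\infty(M)$, $\|D(g)\|$ denotes the supremum over $x\in M$ of the operator norms of the derivative maps $D_x(g)$ and $D_x(g^{-1})$. For a group $\Gamma=\langle S\rangle$ generated by a finite set $S$, $|g|_S$ denotes the word length of $g\in\Gamma$ with respect to $S$. A finitely generated subgroup $\Gamma=\langle S\rangle$ of $\mathrm{Diff}^\infty(M)$ has sub-exponential growth of derivatives if for every $\varepsilon>0$ there is a constant $C_\varepsilon$ such that $\|D(g)\|\le C_\varepsilon e^{\varepsilon|g|_S}$ for every $g\in\Gamma$. (This does not depend on the choice of the finite generating set $S$ or of the metric on $M$.) If this does not hold, $\Gamma$ has exponential growth of derivatives. A diffeomorphism $g$ preserves a Riemannian metric $m_g$ if $g^*m_g=m_g$. *)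

theory Defs
  imports "HOL-Analysis.Analysis" "HOL-Algebra.Bij" "HOL-Algebra.Generated_Groups"
begin

text \<open>A manifold is represented by a smooth submanifold \<open>M\<close> of a Euclidean space \<open>'a\<close>.\<close>

section \<open>Smooth maps and diffeomorphisms\<close>

primrec Ck_on :: "nat \<Rightarrow> ('a::euclidean_space \<Rightarrow> 'b::real_normed_vector) \<Rightarrow> 'a set \<Rightarrow> bool" where
  "Ck_on 0 f U \<longleftrightarrow> continuous_on U f"
| "Ck_on (Suc k) f U \<longleftrightarrow>
     (\<forall>x\<in>U. f differentiable (at x)) \<and>
     (\<forall>v. Ck_on k (\<lambda>x. frechet_derivative f (at x) v) U)"

text \<open>\<open>Ck_on\<close> is meant for open \<open>U\<close>. A map on an arbitrary subset of Euclidean space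
  is smooth if near every point it has a smooth extension to an open set of the ambient space.\<close>

definition smooth_map_on :: "'a::euclidean_space set \<Rightarrow> ('a \<Rightarrow> 'b::real_normed_vector) \<Rightarrow> bool" where
  "smooth_map_on M f \<longleftrightarrow>
     (\<forall>x\<in>M. \<exists>U F. open U \<and> x \<in> U \<and> (\<forall>k. Ck_on k F U) \<and> (\<forall>y\<in>M \<inter> U. F y = f y))"

text \<open>As in \<^const>\<open>BijGroup\<close>, diffeomorphisms of \<open>M\<close> are \<^const>\<open>undefined\<close> outside \<open>M\<close>, so that
  equality of functions is equality of diffeomorphisms.\<close>

definition Diff :: "'a::euclidean_space set \<Rightarrow> ('a \<Rightarrow> 'a) monoid" where
  "Diff M = BijGroup M
     \<lparr>carrier := {g \<in> Bij M. smooth_map_on M g \<and> smooth_map_on M (inv_into M g)}\<rparr>"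

section \<open>Tangent spaces and Riemannian metrics\<close>

definition tangent_space :: "'a::euclidean_space set \<Rightarrow> 'a \<Rightarrow> 'a set" where
  "tangent_space M x =
     {v. \<exists>\<gamma> \<epsilon>. \<epsilon> > (0::real) \<and> (\<forall>k. Ck_on k \<gamma> {-\<epsilon><..<\<epsilon>}) \<and> \<gamma> ` {-\<epsilon><..<\<epsilon>} \<subseteq> M \<and>
           \<gamma> 0 = x \<and> (\<gamma> has_vector_derivative v) (at 0)}"

text \<open>For a smooth map \<open>g\<close> on \<open>M\<close>, the derivative of \<open>g\<close> within \<open>M\<close> is not unique as a linear map
  of the ambient space, but its values on \<^term>\<open>tangent_space M x\<close> are; only these are used below.\<close>

definition tangent_map :: "'a::euclidean_space set \<Rightarrow> ('a \<Rightarrow> 'a) \<Rightarrow> 'a \<Rightarrow> 'a \<Rightarrow> 'a" where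
  "tangent_map M g x = frechet_derivative g (at x within M)"

definition smooth_vector_field :: "'a::euclidean_space set \<Rightarrow> ('a \<Rightarrow> 'a) \<Rightarrow> bool" where
  "smooth_vector_field M X \<longleftrightarrow> smooth_map_on M X \<and> (\<forall>x\<in>M. X x \<in> tangent_space M x)"

text \<open>The values of a metric \<open>h\<close> at points outside \<open>M\<close> or at vectors that are not tangent to \<open>M\<close>
  are unconstrained and never used.\<close>

definition riemannian_metric :: "'a::euclidean_space set \<Rightarrow> ('a \<Rightarrow> 'a \<Rightarrow> 'a \<Rightarrow> real) \<Rightarrow> bool" where
  "riemannian_metric M h \<longleftrightarrow>
     (\<forall>x\<in>M.
        (\<forall>u\<in>tangent_space M x. \<forall>v\<in>tangent_space M x. h x u v = h x v u) \<and>
        (\<forall>u\<in>tangent_space M x. \<forall>v\<in>tangent_space M x. \<forall>w\<in>tangent_space M x.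
           h x (u + v) w = h x u w + h x v w) \<and>
        (\<forall>c. \<forall>u\<in>tangent_space M x. \<forall>v\<in>tangent_space M x. h x (c *\<^sub>R u) v = c * h x u v) \<and>
        (\<forall>v\<in>tangent_space M x. v \<noteq> 0 \<longrightarrow> h x v v > 0)) \<and>
     (\<forall>X Y. smooth_vector_field M X \<longrightarrow> smooth_vector_field M Y \<longrightarrow>
        smooth_map_on M (\<lambda>x. h x (X x) (Y x)))"

definition pullback_metric ::
    "'a::euclidean_space set \<Rightarrow> ('a \<Rightarrow> 'a) \<Rightarrow> ('a \<Rightarrow> 'a \<Rightarrow> 'a \<Rightarrow> real) \<Rightarrow> 'a \<Rightarrow> 'a \<Rightarrow> 'a \<Rightarrow> real" where
  "pullback_metric M g h x u v = h (g x) (tangent_map M g x u) (tangent_map M g x v)"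

definition preserves_metric ::
    "'a::euclidean_space set \<Rightarrow> ('a \<Rightarrow> 'a) \<Rightarrow> ('a \<Rightarrow> 'a \<Rightarrow> 'a \<Rightarrow> real) \<Rightarrow> bool" where
  "preserves_metric M g h \<longleftrightarrow>
     (\<forall>x\<in>M. \<forall>u\<in>tangent_space M x. \<forall>v\<in>tangent_space M x. pullback_metric M g h x u v = h x u v)"

section \<open>Growth of derivatives\<close>

definition metric_norm :: "('a \<Rightarrow> 'a \<Rightarrow> 'a \<Rightarrow> real) \<Rightarrow> 'a \<Rightarrow> 'a \<Rightarrow> real" where
  "metric_norm h x v = sqrt (h x v v)"

text \<open>Suprema are taken in the extended reals, so that they are meaningful without a prior proof of
  boundedness.\<close>

definition tangent_map_norm ::
    "'a::euclidean_space set \<Rightarrow> ('a \<Rightarrow> 'a \<Rightarrow> 'a \<Rightarrow> real) \<Rightarrow> ('a \<Rightarrow> 'a) \<Rightarrow> 'a \<Rightarrow> ereal" where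
  "tangent_map_norm M h g x =
     (SUP v\<in>tangent_space M x - {0}.
        ereal (metric_norm h (g x) (tangent_map M g x v) / metric_norm h x v))"

definition derivative_norm ::
    "'a::euclidean_space set \<Rightarrow> ('a \<Rightarrow> 'a \<Rightarrow> 'a \<Rightarrow> real) \<Rightarrow> ('a \<Rightarrow> 'a) \<Rightarrow> ereal" where
  "derivative_norm M h g =
     (SUP x\<in>M. max (tangent_map_norm M h g x) (tangent_map_norm M h (inv_into M g) x))"

definition finitely_generated_by :: "('g, 'm) monoid_scheme \<Rightarrow> 'g set \<Rightarrow> 'g set \<Rightarrow> bool" where
  "finitely_generated_by G \<Gamma> S \<longleftrightarrow> finite S \<and> S \<subseteq> carrier G \<and> generate G S = \<Gamma>"

definition word_length :: "('g, 'm) monoid_scheme \<Rightarrow> 'g set \<Rightarrow> 'g \<Rightarrow> nat" where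
  "word_length G S g =
     (LEAST n. \<exists>w. length w = n \<and> set w \<subseteq> S \<union> (\<lambda>s. inv\<^bsub>G\<^esub> s) ` S \<and>
        foldr (\<lambda>s t. s \<otimes>\<^bsub>G\<^esub> t) w \<one>\<^bsub>G\<^esub> = g)"

definition subexponential_derivative_growth ::
    "'a::euclidean_space set \<Rightarrow> ('a \<Rightarrow> 'a \<Rightarrow> 'a \<Rightarrow> real) \<Rightarrow> ('a \<Rightarrow> 'a) set \<Rightarrow> ('a \<Rightarrow> 'a) set \<Rightarrow> bool" where
  "subexponential_derivative_growth M h \<Gamma> S \<longleftrightarrow>
     (\<forall>\<epsilon>>0. \<exists>C::real. \<forall>g\<in>\<Gamma>.
        derivative_norm M h g \<le> ereal (C * exp (\<epsilon> * real (word_length (Diff M) S g))))"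

text \<open>Failure of subexponential growth does not depend on the metric \<open>h\<close> nor on the finite generating
  set \<open>S\<close>; accordingly it is required for all of them.\<close>

definition exponential_derivative_growth :: "'a::euclidean_space set \<Rightarrow> ('a \<Rightarrow> 'a) set \<Rightarrow> bool" where
  "exponential_derivative_growth M \<Gamma> \<longleftrightarrow>
     (\<forall>h S. riemannian_metric M h \<longrightarrow> finitely_generated_by (Diff M) \<Gamma> S \<longrightarrow>
        \<not> subexponential_derivative_growth M h \<Gamma> S)"

section \<open>The manifold\<close>

definition S3xS1 :: "((real^4) \<times> (real^2)) set" where
  "S3xS1 = sphere 0 1 \<times> sphere 0 1"

end

theory Submission
  imports Defs
begin

text \<open>Let \<open>\<Phi>\<close> be the flow on the circle whose map for the time \<open>t\<close> is, in stereographic projection, the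
  multiplication by \<open>e\<^sup>-\<^sup>t\<close>. View the three-sphere as the group of unit quaternions. The group
  consists of skew products: a unit quaternion \<open>a\<close> and a vector \<open>t\<close> of \<open>\<real>\<^sup>4\<close> give the diffeomorphism
  that sends \<open>x\<close> to \<open>a \<star> x\<close> and moves the circle over \<open>x\<close> by \<open>\<Phi>\<close> for the time \<open>t \<bullet> x\<close>. Composition makes
  \<open>t\<close> a cocycle over the rotation \<open>a\<close>, with values in the linear functions on \<open>\<real>\<^sup>4\<close>.

  Two observations on a single pair \<open>(a, t)\<close> turn the theorem into a statement on this cocycle. On the
  one hand, if \<open>t\<close> is a coboundary, that is \<open>t \<bullet> x = u \<bullet> (a \<star> x) - u \<bullet> x\<close> for some \<open>u\<close>, then moving the
  circle over \<open>x\<close> by the flow for the time \<open>- (u \<bullet> x)\<close> conjugates the map to an isometry, so a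
  metric is preserved (\<open>skew_coboundary_preserves_metric\<close>). This is automatic if \<open>a\<close> is not 1, because
  then \<open>a\<close> has no eigenvalue 1 (\<open>unit_quat_coboundary\<close>). On the other hand, at a fixed point of
  the flow the derivative along the circle over \<open>x\<close> is \<open>e\<close> to the power \<open>- (t \<bullet> x)\<close>, so the norm of
  the derivative is at least a constant times \<open>e\<close> to the power \<open>norm t\<close>
  (\<open>derivative_norm_skew_lower_bound\<close>).

  It remains to find a finitely generated group of pairs in which \<open>a = 1\<close> forces \<open>t = 0\<close> and the norm of
  \<open>t\<close> grows linearly along some sequence of words. For the first property it suffices that the
  rotation parts of the generators are free; then the translation parts may be arbitrary. The unit
  quaternions \<open>(3 + 4 i) / 5\<close>, \<open>(3 + 4 j) / 5\<close>, \<open>(3 + 4 k) / 5\<close> are free, because a reduced product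
  of their numerators is not divisible by 5 (\<open>motion_trivial_rotation\<close>). For the second property the
  generators are given cocycles with three different primitives, such that the translation
  parts of the generators and their inverses positively span \<open>\<real>\<^sup>4\<close>. Any \<open>t\<close> can then be pushed
  outward by a suitable further letter (\<open>motion_linear_growth\<close>). Every element has a primitive of its
  own, but there is none for the whole group.

  A metric preserved by the whole group would bound all derivatives and contradict
  exponential growth (\<open>subexponential_if_common_metric\<close>), so the preserved metric has to vary with the
  element.\<close>

section \<open>Calculus of \<open>C\<^sup>k\<close> maps\<close>

lemma Ck_on_subset: "Ck_on k f U \<Longrightarrow> V \<subseteq> U \<Longrightarrow> Ck_on k f V"
proof (induction k arbitrary: f)
  case 0
  then show ?case by (auto intro: continuous_on_subset)
next
  case (Suc k)
  then show ?case by auto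
qed

lemma Ck_on_cong:
  assumes "open U" "\<And>x. x \<in> U \<Longrightarrow> f x = g x" "Ck_on k f U"
  shows "Ck_on k g U"
  using assms(2,3)
proof (induction k arbitrary: f g)
  case 0
  then show ?case using continuous_on_cong by force
next
  case (Suc k)
  have D: "(g has_derivative frechet_derivative f (at x)) (at x)" if "x \<in> U" for x
    using Suc.prems that assms(1)
    by (auto intro: has_derivative_transform_within_open[of f _ x UNIV U g] simp: frechet_derivative_works)
  then have "frechet_derivative f (at x) = frechet_derivative g (at x)" if "x \<in> U" for x
    using that frechet_derivative_at by blast
  then have "Ck_on k (\<lambda>x. frechet_derivative g (at x) v) U" for v
    using Suc.IH[of "\<lambda>x. frechet_derivative f (at x) v" "\<lambda>x. frechet_derivative g (at x) v"] Suc.prems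
    by simp
  then show ?case using D by (auto simp: differentiable_def)
qed

lemma Ck_on_SucI:
  assumes "open U" "\<And>x. x \<in> U \<Longrightarrow> (f has_derivative f' x) (at x)" "\<And>v. Ck_on k (\<lambda>x. f' x v) U"
  shows "Ck_on (Suc k) f U"
proof -
  have "Ck_on k (\<lambda>x. frechet_derivative f (at x) v) U" for v
    by (rule Ck_on_cong[OF assms(1) _ assms(3)[of v]]) (metis assms(2) frechet_derivative_at)
  then show ?thesis using assms(2) by (auto simp: differentiable_def)
qed

lemma Ck_on_SucD:
  assumes "Ck_on (Suc k) f U"
  shows "x \<in> U \<Longrightarrow> (f has_derivative frechet_derivative f (at x)) (at x)"
    and "Ck_on k (\<lambda>x. frechet_derivative f (at x) v) U"
  using assms by (auto simp: frechet_derivative_works)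

lemma Ck_on_Suc_imp: "Ck_on (Suc k) f U \<Longrightarrow> Ck_on k f U"
proof (induction k arbitrary: f)
  case 0
  then show ?case
    by (simp add: continuous_at_imp_continuous_on differentiable_imp_continuous_within)
next
  case (Suc k)
  then have "Ck_on k (\<lambda>x. frechet_derivative f (at x) v) U" for v
    using Ck_on_SucD(2) by blast
  then show ?case using Suc.prems by auto
qed

lemma Ck_on_const: "open U \<Longrightarrow> Ck_on k (\<lambda>x. c) U"
proof (induction k arbitrary: c)
  case (Suc k)
  show ?case by (rule Ck_on_SucI[where f'="\<lambda>x v. 0"]) (use Suc in auto)
qed simp

lemma Ck_on_add:
  assumes "open U"
  shows "Ck_on k f U \<Longrightarrow> Ck_on k g U \<Longrightarrow> Ck_on k (\<lambda>x. f x + g x) U"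
proof (induction k arbitrary: f g)
  case 0
  then show ?case by (simp add: continuous_on_add)
next
  case (Suc k)
  note D = Ck_on_SucD[OF Suc.prems(1)] Ck_on_SucD[OF Suc.prems(2)]
  show ?case
    by (rule Ck_on_SucI[OF assms has_derivative_add[OF D(1,3)] Suc.IH[OF D(2,4)]])
qed

lemma Ck_on_bounded_linear:
  assumes "open U" "bounded_linear L"
  shows "Ck_on k f U \<Longrightarrow> Ck_on k (\<lambda>x. L (f x)) U"
proof (induction k arbitrary: f)
  case 0
  then show ?case using assms(2) by (simp add: bounded_linear.continuous_on)
next
  case (Suc k)
  note D = Ck_on_SucD[OF Suc.prems]
  show ?case
    by (rule Ck_on_SucI[OF assms(1) bounded_linear.has_derivative[OF assms(2) D(1)] Suc.IH[OF D(2)]])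
qed

lemma Ck_on_bounded_bilinear:
  assumes "open U" "bounded_bilinear B"
  shows "Ck_on k f U \<Longrightarrow> Ck_on k g U \<Longrightarrow> Ck_on k (\<lambda>x. B (f x) (g x)) U"
proof (induction k arbitrary: f g)
  case 0
  then show ?case using assms(2) by (simp add: bounded_bilinear.continuous_on)
next
  case (Suc k)
  note D = Ck_on_SucD[OF Suc.prems(1)] Ck_on_SucD[OF Suc.prems(2)]
  show ?case
  proof (rule Ck_on_SucI[OF assms(1) bounded_bilinear.FDERIV[OF assms(2) D(1,3)]])
    show "Ck_on k (\<lambda>x. B (f x) (frechet_derivative g (at x) v) + B (frechet_derivative f (at x) v) (g x)) U" for v
      by (intro Ck_on_add assms(1) Suc.IH[OF Ck_on_Suc_imp[OF Suc.prems(1)] D(4)]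
          Suc.IH[OF D(2) Ck_on_Suc_imp[OF Suc.prems(2)]])
  qed
qed

lemma Ck_on_sum:
  assumes "open U" "\<And>i. i \<in> I \<Longrightarrow> Ck_on k (f i) U"
  shows "Ck_on k (\<lambda>x. \<Sum>i\<in>I. f i x) U"
  using assms(2)
  by (induction I rule: infinite_finite_induct) (auto intro: Ck_on_const Ck_on_add assms(1))

lemma linear_eq_sum_Basis:
  fixes L :: "'a::euclidean_space \<Rightarrow> 'b::real_vector"
  assumes "linear L"
  shows "L v = (\<Sum>b\<in>Basis. (v \<bullet> b) *\<^sub>R L b)"
proof -
  have "L v = L (\<Sum>b\<in>Basis. (v \<bullet> b) *\<^sub>R b)" by (simp add: euclidean_representation)
  also have "\<dots> = (\<Sum>b\<in>Basis. (v \<bullet> b) *\<^sub>R L b)"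
    using assms by (simp add: linear_sum linear_scale)
  finally show ?thesis .
qed

text \<open>The derivative of a composition is \<open>D g (f x) (D f x v)\<close>, in which both the linear map and its
  argument vary with \<open>x\<close>. Expanding the argument in a basis reduces this to products and to
  compositions with the partial derivatives of the outer map, which are one class less smooth, so
  that an induction on \<open>k\<close> applies.\<close>

lemma Ck_on_directional:
  fixes X :: "'a::euclidean_space \<Rightarrow> 'b::euclidean_space" and L :: "'a \<Rightarrow> 'b \<Rightarrow> 'c::real_normed_vector"
  assumes "open U" "\<And>x. x \<in> U \<Longrightarrow> linear (L x)" "\<And>b. Ck_on k (\<lambda>x. L x b) U" "Ck_on k X U"
  shows "Ck_on k (\<lambda>x. L x (X x)) U"
proof (rule Ck_on_cong[OF assms(1)])
  show "(\<Sum>b\<in>Basis. (X x \<bullet> b) *\<^sub>R L x b) = L x (X x)" if "x \<in> U" for x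
    using linear_eq_sum_Basis[OF assms(2)[OF that], of "X x"] by simp
  show "Ck_on k (\<lambda>x. \<Sum>b\<in>Basis. (X x \<bullet> b) *\<^sub>R L x b) U"
    by (intro Ck_on_sum Ck_on_bounded_bilinear[where B="(*\<^sub>R)"] Ck_on_bounded_linear[where L="\<lambda>x. x \<bullet> b" for b]
        assms bounded_bilinear_scaleR bounded_linear_inner_left)
qed

lemma Ck_on_compose:
  fixes f :: "'a::euclidean_space \<Rightarrow> 'b::euclidean_space" and g :: "'b \<Rightarrow> 'c::real_normed_vector"
  assumes "open U" "open V"
  shows "Ck_on k g V \<Longrightarrow> Ck_on k f U \<Longrightarrow> f ` U \<subseteq> V \<Longrightarrow> Ck_on k (\<lambda>x. g (f x)) U"
proof (induction k arbitrary: f g)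
  case 0
  then show ?case by (auto intro: continuous_on_compose2)
next
  case (Suc k)
  note D = Ck_on_SucD[OF Suc.prems(1)] Ck_on_SucD[OF Suc.prems(2)]
  let ?g' = "\<lambda>y. frechet_derivative g (at y)" and ?f' = "\<lambda>x. frechet_derivative f (at x)"
  show ?case
  proof (rule Ck_on_SucI[OF assms(1), where f'="\<lambda>x v. ?g' (f x) (?f' x v)"])
    show "((\<lambda>x. g (f x)) has_derivative (\<lambda>v. ?g' (f x) (?f' x v))) (at x)" if "x \<in> U" for x
      using has_derivative_compose[OF D(3)[OF that] D(1)] that Suc.prems(3) by auto
    show "Ck_on k (\<lambda>x. ?g' (f x) (?f' x v)) U" for v
    proof (rule Ck_on_directional[OF assms(1) _ _ D(4)])
      show "linear (?g' (f x))" if "x \<in> U" for x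
        using D(1) that Suc.prems(3) has_derivative_linear by blast
      show "Ck_on k (\<lambda>x. ?g' (f x) b) U" for b
        using Suc.IH[OF D(2) Ck_on_Suc_imp[OF Suc.prems(2)] Suc.prems(3)] .
    qed
  qed
qed

lemma Ck_on_ident: "open U \<Longrightarrow> Ck_on k (\<lambda>x. x) U"
proof (cases k)
  case (Suc j)
  assume "open U"
  then show ?thesis unfolding Suc
    by (intro Ck_on_SucI[where f'="\<lambda>x v. v"] Ck_on_const) auto
qed simp

lemma Ck_on_mult:
  fixes f g :: "'a::euclidean_space \<Rightarrow> real"
  shows "open U \<Longrightarrow> Ck_on k f U \<Longrightarrow> Ck_on k g U \<Longrightarrow> Ck_on k (\<lambda>x. f x * g x) U"
  by (rule Ck_on_bounded_bilinear[OF _ bounded_bilinear_mult])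

lemma Ck_on_exp: "Ck_on k (exp :: real \<Rightarrow> real) UNIV"
proof (induction k)
  case 0
  show ?case by (simp add: continuous_on_exp)
next
  case (Suc k)
  show ?case
  proof (rule Ck_on_SucI[where f'="\<lambda>x v. exp x * v"])
    show "Ck_on k (\<lambda>x. exp x * v) UNIV" for v :: real
      by (intro Ck_on_mult Suc Ck_on_const open_UNIV)
  qed (auto intro!: derivative_eq_intros)
qed

text \<open>Each of the two functions is, up to sign, the derivative of the other; hence the simultaneous induction.\<close>

lemma Ck_on_sin_cos:
  "Ck_on k (sin :: real \<Rightarrow> real) UNIV \<and> Ck_on k (cos :: real \<Rightarrow> real) UNIV"
proof (induction k)
  case 0
  show ?case by (simp add: continuous_on_sin continuous_on_cos)
next
  case (Suc k)
  have "Ck_on (Suc k) (sin :: real \<Rightarrow> real) UNIV"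
  proof (rule Ck_on_SucI[where f'="\<lambda>x v. cos x * v"])
    show "Ck_on k (\<lambda>x. cos x * v) UNIV" for v :: real
      by (intro Ck_on_mult Suc[THEN conjunct2] Ck_on_const open_UNIV)
  qed (auto intro!: derivative_eq_intros)
  moreover have "Ck_on (Suc k) (cos :: real \<Rightarrow> real) UNIV"
  proof (rule Ck_on_SucI[where f'="\<lambda>x v. sin x * (- v)"])
    show "Ck_on k (\<lambda>x. sin x * (- v)) UNIV" for v :: real
      by (intro Ck_on_mult Suc[THEN conjunct1] Ck_on_const open_UNIV)
  qed (auto intro!: derivative_eq_intros)
  ultimately show ?case by blast
qed

lemma Ck_on_inverse: "Ck_on k (inverse :: real \<Rightarrow> real) (- {0})"
proof (induction k)
  case 0
  show ?case by (auto intro!: continuous_intros)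
next
  case (Suc k)
  show ?case
  proof (rule Ck_on_SucI[where f'="\<lambda>x v. (inverse x * inverse x) * (- v)"])
    show "(inverse has_derivative (\<lambda>v. (inverse x * inverse x) * (- v))) (at x)" if "x \<in> - {0}" for x :: real
      using that by (auto intro!: derivative_eq_intros)
    show "Ck_on k (\<lambda>x. (inverse x * inverse x) * (- v)) (- {0})" for v :: real
      by (intro Ck_on_mult Suc Ck_on_const) auto
  qed auto
qed

text \<open>Openness is part of the notion: at a boundary point of the domain the derivatives in
  \<^const>\<open>Ck_on\<close> would depend on the values outside.\<close>

definition smooth_on :: "('a::euclidean_space \<Rightarrow> 'b::real_normed_vector) \<Rightarrow> 'a set \<Rightarrow> bool" where
  "smooth_on f U \<longleftrightarrow> open U \<and> (\<forall>k. Ck_on k f U)"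

lemma smooth_on_const: "open U \<Longrightarrow> smooth_on (\<lambda>x. c) U"
  by (simp add: smooth_on_def Ck_on_const)

lemma smooth_on_ident: "open U \<Longrightarrow> smooth_on (\<lambda>x. x) U"
  by (simp add: smooth_on_def Ck_on_ident)

lemma smooth_on_add: "smooth_on f U \<Longrightarrow> smooth_on g U \<Longrightarrow> smooth_on (\<lambda>x. f x + g x) U"
  by (simp add: smooth_on_def Ck_on_add)

lemma smooth_on_bounded_linear: "bounded_linear L \<Longrightarrow> smooth_on f U \<Longrightarrow> smooth_on (\<lambda>x. L (f x)) U"
  by (simp add: smooth_on_def Ck_on_bounded_linear)

lemma smooth_on_bounded_bilinear:
  "bounded_bilinear B \<Longrightarrow> smooth_on f U \<Longrightarrow> smooth_on g U \<Longrightarrow> smooth_on (\<lambda>x. B (f x) (g x)) U"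
  by (simp add: smooth_on_def Ck_on_bounded_bilinear)

lemmas smooth_on_scaleR = smooth_on_bounded_bilinear[OF bounded_bilinear_scaleR]
lemmas smooth_on_inner = smooth_on_bounded_bilinear[OF bounded_bilinear_inner]
lemmas smooth_on_mult = smooth_on_bounded_bilinear[OF bounded_bilinear_mult]

lemma smooth_on_minus: "smooth_on f U \<Longrightarrow> smooth_on (\<lambda>x. - f x) U"
  by (rule smooth_on_bounded_linear[OF bounded_linear_minus[OF bounded_linear_ident]])

lemma smooth_on_diff: "smooth_on f U \<Longrightarrow> smooth_on g U \<Longrightarrow> smooth_on (\<lambda>x. f x - g x) U"
  using smooth_on_add[OF _ smooth_on_minus] by fastforce

lemma smooth_on_Pair:
  assumes "smooth_on f U" "smooth_on g U"
  shows "smooth_on (\<lambda>x. (f x, g x)) U"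
proof -
  have "smooth_on (\<lambda>x. (f x, 0) + (0, g x)) U"
    using assms
    by (intro smooth_on_add smooth_on_bounded_linear[where L="\<lambda>y. (y, 0)"] smooth_on_bounded_linear[where L="\<lambda>y. (0, y)"])
      (auto intro!: bounded_linear_Pair bounded_linear_ident bounded_linear_zero)
  then show ?thesis by simp
qed

lemma smooth_on_compose:
  "smooth_on g V \<Longrightarrow> smooth_on f U \<Longrightarrow> f ` U \<subseteq> V \<Longrightarrow> smooth_on (\<lambda>x. g (f x)) U"
  unfolding smooth_on_def using Ck_on_compose by blast

lemma smooth_on_exp: "smooth_on f U \<Longrightarrow> smooth_on (\<lambda>x. exp (f x :: real)) U"
  by (rule smooth_on_compose[of exp UNIV]) (auto simp: smooth_on_def Ck_on_exp)

lemma smooth_on_sin: "smooth_on f U \<Longrightarrow> smooth_on (\<lambda>x. sin (f x :: real)) U"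
  by (rule smooth_on_compose[of sin UNIV]) (auto simp: smooth_on_def Ck_on_sin_cos)

lemma smooth_on_cos: "smooth_on f U \<Longrightarrow> smooth_on (\<lambda>x. cos (f x :: real)) U"
  by (rule smooth_on_compose[of cos UNIV]) (auto simp: smooth_on_def Ck_on_sin_cos)

lemma smooth_on_inverse:
  "smooth_on f U \<Longrightarrow> (\<And>x. x \<in> U \<Longrightarrow> f x \<noteq> 0) \<Longrightarrow> smooth_on (\<lambda>x. inverse (f x :: real)) U"
  by (rule smooth_on_compose[of inverse "- {0}"]) (auto simp: smooth_on_def Ck_on_inverse)

lemma smooth_on_subset: "smooth_on f U \<Longrightarrow> V \<subseteq> U \<Longrightarrow> open V \<Longrightarrow> smooth_on f V"
  by (auto simp: smooth_on_def intro: Ck_on_subset)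

lemma smooth_on_imp_continuous_on: "smooth_on f U \<Longrightarrow> continuous_on U f"
  unfolding smooth_on_def by (metis Ck_on.simps(1))

lemma smooth_on_has_derivative:
  "smooth_on f U \<Longrightarrow> x \<in> U \<Longrightarrow> (f has_derivative frechet_derivative f (at x)) (at x)"
  unfolding smooth_on_def using Ck_on_SucD(1) by blast

lemma smooth_on_directional_derivative:
  assumes "smooth_on f U" "smooth_on X U"
  shows "smooth_on (\<lambda>x. frechet_derivative f (at x) (X x)) U"
proof -
  have "Ck_on k (\<lambda>x. frechet_derivative f (at x) (X x)) U" for k
  proof (rule Ck_on_directional[where L="\<lambda>x. frechet_derivative f (at x)"])
    show "Ck_on k (\<lambda>x. frechet_derivative f (at x) b) U" for b
      using assms(1) Ck_on_SucD(2)[of k f U b] by (simp add: smooth_on_def del: Ck_on.simps)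
    show "linear (frechet_derivative f (at x))" if "x \<in> U" for x
      using smooth_on_has_derivative[OF assms(1) that] has_derivative_linear by blast
  qed (use assms in \<open>auto simp: smooth_on_def\<close>)
  then show ?thesis using assms by (simp add: smooth_on_def)
qed

section \<open>Smooth maps between subsets of Euclidean spaces\<close>

lemma smooth_map_on_iff:
  "smooth_map_on M f \<longleftrightarrow> (\<forall>x\<in>M. \<exists>U F. x \<in> U \<and> smooth_on F U \<and> (\<forall>y\<in>M \<inter> U. F y = f y))"
  unfolding smooth_map_on_def smooth_on_def by blast

lemma smooth_map_on_of_smooth_on:
  "smooth_on F U \<Longrightarrow> M \<subseteq> U \<Longrightarrow> (\<And>y. y \<in> M \<Longrightarrow> F y = f y) \<Longrightarrow> smooth_map_on M f"
  unfolding smooth_map_on_iff by blast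

lemma smooth_map_on_cong:
  "smooth_map_on M f \<Longrightarrow> (\<And>y. y \<in> M \<Longrightarrow> f y = g y) \<Longrightarrow> smooth_map_on M g"
  unfolding smooth_map_on_iff by (metis IntD1)

lemma smooth_map_on_compose:
  assumes "smooth_map_on N g" "smooth_map_on M f" "f ` M \<subseteq> N"
  shows "smooth_map_on M (\<lambda>x. g (f x))"
  unfolding smooth_map_on_iff
proof
  fix x assume x: "x \<in> M"
  obtain U F where F: "x \<in> U" "smooth_on F U" "\<forall>y\<in>M \<inter> U. F y = f y"
    using assms(2) x unfolding smooth_map_on_iff by blast
  obtain V G where G: "f x \<in> V" "smooth_on G V" "\<forall>y\<in>N \<inter> V. G y = g y"
    using assms(1,3) x unfolding smooth_map_on_iff by blast
  let ?W = "U \<inter> F -` V"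
  have "open ?W"
    using continuous_open_preimage[OF smooth_on_imp_continuous_on[OF F(2)]] F(2) G(2)
    by (simp add: smooth_on_def)
  then have "smooth_on F ?W" by (rule smooth_on_subset[OF F(2) Int_lower1])
  then have "smooth_on (\<lambda>x. G (F x)) ?W" by (rule smooth_on_compose[OF G(2)]) auto
  moreover have "x \<in> ?W" using F(1,3) G(1) x by simp
  moreover have "\<forall>y\<in>M \<inter> ?W. G (F y) = g (f y)" using F(3) G(3) assms(3) by (auto simp: image_subset_iff)
  ultimately show "\<exists>U F. x \<in> U \<and> smooth_on F U \<and> (\<forall>y\<in>M \<inter> U. F y = g (f y))" by (intro exI conjI)
qed

lemma has_derivative_of_local_extension:
  assumes "open U" "x \<in> M" "x \<in> U" "\<forall>y\<in>M \<inter> U. F y = f y" "(F has_derivative D) (at x)"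
  shows "(f has_derivative D) (at x within M)"
proof (rule has_derivative_transform_eventually[OF has_derivative_at_withinI[OF assms(5)]])
  show "\<forall>\<^sub>F y in at x within M. F y = f y"
    unfolding eventually_at_topological using assms(1,3,4) by blast
qed (use assms in auto)

lemma smooth_map_on_imp_differentiable:
  assumes "smooth_map_on M f" "x \<in> M"
  shows "f differentiable (at x within M)"
proof -
  obtain U F where F: "x \<in> U" "smooth_on F U" "\<forall>y\<in>M \<inter> U. F y = f y"
    using assms unfolding smooth_map_on_iff by blast
  have "(f has_derivative frechet_derivative F (at x)) (at x within M)"
    using has_derivative_of_local_extension[OF _ assms(2) F(1,3) smooth_on_has_derivative[OF F(2,1)]] F(2)
    by (simp add: smooth_on_def)
  then show ?thesis by (auto simp: differentiable_def)
qed

lemma smooth_map_on_imp_continuous_on: "smooth_map_on M f \<Longrightarrow> continuous_on M f"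
  using smooth_map_on_imp_differentiable differentiable_imp_continuous_within
  unfolding continuous_on_eq_continuous_within by blast

section \<open>The diffeomorphism group\<close>

lemma Diff_simps:
  "carrier (Diff M) = {g \<in> Bij M. smooth_map_on M g \<and> smooth_map_on M (inv_into M g)}"
  "\<one>\<^bsub>Diff M\<^esub> = (\<lambda>x\<in>M. x)"
  "g \<in> carrier (Diff M) \<Longrightarrow> f \<in> carrier (Diff M) \<Longrightarrow> g \<otimes>\<^bsub>Diff M\<^esub> f = compose M g f"
  by (simp_all add: Diff_def BijGroup_def)

lemma DiffD:
  assumes "g \<in> carrier (Diff M)"
  shows "g \<in> Bij M" "bij_betw g M M" "g ` M = M" "smooth_map_on M g" "smooth_map_on M (inv_into M g)"
  using assms by (auto simp: Diff_simps Bij_def bij_betw_def)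

text \<open>Diffeomorphisms are \<^const>\<open>undefined\<close> outside the manifold, while explicit formulas are not:
  a formula gives an element of the group after restriction, and smoothness of the inverse
  is seen from a second formula.\<close>

lemma restrict_in_Diff:
  assumes "smooth_map_on M f" "smooth_map_on M g"
    and "\<And>x. x \<in> M \<Longrightarrow> f x \<in> M" "\<And>x. x \<in> M \<Longrightarrow> g x \<in> M"
    and "\<And>x. x \<in> M \<Longrightarrow> g (f x) = x" "\<And>x. x \<in> M \<Longrightarrow> f (g x) = x"
  shows "restrict f M \<in> carrier (Diff M)"
proof -
  have "bij_betw f M M" by (rule bij_betw_byWitness[where f'=g]) (use assms(3-6) in blast)+
  then have bij: "bij_betw (restrict f M) M M" by (subst bij_betw_cong[where g=f]) simp_all
  have inv: "inv_into M (restrict f M) y = g y" if "y \<in> M" for y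
    by (rule inv_into_f_eq[OF bij_betw_imp_inj_on[OF bij] assms(4)[OF that]])
      (simp add: assms(4,6) that)
  have "smooth_map_on M (inv_into M (restrict f M))"
    by (rule smooth_map_on_cong[OF assms(2)]) (simp add: inv)
  moreover have "smooth_map_on M (restrict f M)"
    by (rule smooth_map_on_cong[OF assms(1)]) simp
  ultimately show ?thesis using bij by (simp add: Diff_simps Bij_def)
qed

lemma subgroup_Diff: "subgroup (carrier (Diff M)) (BijGroup M)"
proof (rule group.subgroupI[OF group_BijGroup])
  show "carrier (Diff M) \<subseteq> carrier (BijGroup M)" by (auto simp: Diff_simps BijGroup_def)
  have "restrict (\<lambda>x. x) M \<in> carrier (Diff M)"
    by (rule restrict_in_Diff[where g="\<lambda>x. x"]) (auto intro: smooth_map_on_of_smooth_on[OF smooth_on_ident[of UNIV]])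
  then show "carrier (Diff M) \<noteq> {}" by blast
next
  fix g assume g: "g \<in> carrier (Diff M)"
  note D = DiffD[OF g]
  have "restrict (inv_into M g) M \<in> carrier (Diff M)"
    by (rule restrict_in_Diff[where g=g])
      (use D in \<open>auto simp: bij_betw_def inv_into_into f_inv_into_f image_iff\<close>)
  then show "inv\<^bsub>BijGroup M\<^esub> g \<in> carrier (Diff M)" using inv_BijGroup[OF D(1)] by simp
next
  fix g f assume g: "g \<in> carrier (Diff M)" and f: "f \<in> carrier (Diff M)"
  note G = DiffD[OF g] note F = DiffD[OF f]
  have "restrict (\<lambda>x. g (f x)) M \<in> carrier (Diff M)"
  proof (rule restrict_in_Diff[where g="\<lambda>x. inv_into M f (inv_into M g x)"])
    show "smooth_map_on M (\<lambda>x. g (f x))"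
      using smooth_map_on_compose[OF G(4) F(4)] F(3) by simp
    show "smooth_map_on M (\<lambda>x. inv_into M f (inv_into M g x))"
      using smooth_map_on_compose[OF F(5) G(5)] bij_betw_inv_into[OF G(2)] by (simp add: bij_betw_def)
    have F': "f x \<in> M" if "x \<in> M" for x using F(3) that by blast
    show "g (f x) \<in> M" if "x \<in> M" for x using F' G(3) that by blast
    show "inv_into M f (inv_into M g (g (f x))) = x" if "x \<in> M" for x
      using that F' F(2) G(2) by (simp add: bij_betw_def inv_into_f_f)
    show "g (f (inv_into M f (inv_into M g x))) = x" "inv_into M f (inv_into M g x) \<in> M" if "x \<in> M" for x
      using that F(3) G(3) by (simp_all add: inv_into_into f_inv_into_f)
  qed
  then show "g \<otimes>\<^bsub>BijGroup M\<^esub> f \<in> carrier (Diff M)"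
    using F(1) G(1) by (simp add: BijGroup_def compose_def)
qed

lemma group_Diff: "group (Diff M)"
proof -
  have "Diff M = BijGroup M\<lparr>carrier := carrier (Diff M)\<rparr>" by (simp add: Diff_def)
  then show ?thesis
    using subgroup.subgroup_is_group[OF subgroup_Diff group_BijGroup] by metis
qed

lemma Diff_inv:
  assumes "g \<in> carrier (Diff M)"
  shows "inv\<^bsub>Diff M\<^esub> g = restrict (inv_into M g) M"
proof -
  have "Diff M = BijGroup M\<lparr>carrier := carrier (Diff M)\<rparr>" by (simp add: Diff_def)
  then have "inv\<^bsub>Diff M\<^esub> g = inv\<^bsub>BijGroup M\<^esub> g"
    using group.m_inv_consistent[OF group_BijGroup subgroup_Diff assms] by metis
  then show ?thesis using inv_BijGroup[OF DiffD(1)[OF assms]] by simp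
qed

section \<open>Tangent maps and preserved metrics\<close>

text \<open>A derivative within a submanifold is not unique as a linear map of the ambient space. Testing it
  on curves in the submanifold shows that its values on tangent vectors are.\<close>

lemma has_vector_derivative_along_curve:
  fixes \<gamma> :: "real \<Rightarrow> 'a::euclidean_space"
  assumes "(g has_derivative g') (at x within M)"
    and "\<epsilon> > 0" "\<gamma> ` {-\<epsilon><..<\<epsilon>} \<subseteq> M" "\<gamma> 0 = x" "(\<gamma> has_vector_derivative v) (at 0)"
  shows "((\<lambda>s. g (\<gamma> s)) has_vector_derivative g' v) (at 0)"
proof -
  let ?I = "{-\<epsilon><..<\<epsilon>}"
  have "(g has_derivative g') (at (\<gamma> 0) within \<gamma> ` ?I)"
    using assms(1,3,4) has_derivative_subset by blast
  moreover have "(\<gamma> has_derivative (\<lambda>s. s *\<^sub>R v)) (at 0 within ?I)"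
    using assms(5) has_derivative_at_withinI unfolding has_vector_derivative_def by blast
  ultimately have "((\<lambda>s. g (\<gamma> s)) has_derivative (\<lambda>s. g' (s *\<^sub>R v))) (at 0 within ?I)"
    by (intro has_derivative_in_compose[of \<gamma> _ 0 ?I g g'])
  moreover have "(0::real) \<in> ?I" "open ?I" using assms(2) by auto
  ultimately have "((\<lambda>s. g (\<gamma> s)) has_derivative (\<lambda>s. g' (s *\<^sub>R v))) (at 0)"
    using at_within_open by metis
  moreover have "g' (s *\<^sub>R v) = s *\<^sub>R g' v" for s
    using has_derivative_linear[OF assms(1)] linear_scale by blast
  ultimately show ?thesis unfolding has_vector_derivative_def by simp
qed

lemma derivative_unique_on_tangent_space:
  assumes "(g has_derivative g1) (at x within M)" "(g has_derivative g2) (at x within M)"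
    and "v \<in> tangent_space M x"
  shows "g1 v = g2 v"
proof -
  obtain \<gamma> and \<epsilon> :: real where "\<epsilon> > 0" "\<gamma> ` {-\<epsilon><..<\<epsilon>} \<subseteq> M" "\<gamma> 0 = x"
    "(\<gamma> has_vector_derivative v) (at 0)"
    using assms(3) unfolding tangent_space_def by blast
  note c = this
  show ?thesis
    using vector_derivative_unique_at[OF has_vector_derivative_along_curve[OF assms(1) c]
        has_vector_derivative_along_curve[OF assms(2) c]] .
qed

lemma has_derivative_tangent_map:
  "smooth_map_on M g \<Longrightarrow> x \<in> M \<Longrightarrow> (g has_derivative tangent_map M g x) (at x within M)"
  unfolding tangent_map_def using smooth_map_on_imp_differentiable frechet_derivative_works by blast

lemma tangent_map_eqI:
  assumes "(g has_derivative g') (at x within M)" "v \<in> tangent_space M x"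
  shows "tangent_map M g x v = g' v"
  using derivative_unique_on_tangent_space[OF _ assms] assms(1) frechet_derivative_works[of g "at x within M"]
  unfolding tangent_map_def differentiable_def by blast

lemma tangent_map_cong:
  assumes "\<And>y. y \<in> M \<Longrightarrow> f y = g y" "x \<in> M"
  shows "tangent_map M f x = tangent_map M g x"
proof -
  have "(f has_derivative D) (at x within M) \<longleftrightarrow> (g has_derivative D) (at x within M)" for D
    using has_derivative_transform[of x M f g D] has_derivative_transform[of x M g f D] assms by metis
  then show ?thesis unfolding tangent_map_def frechet_derivative_def by simp
qed

lemma has_derivative_compose_within:
  assumes "(f has_derivative f') (at x within M)" "(g has_derivative g') (at (f x) within N)" "f ` M \<subseteq> N"
  shows "((\<lambda>x. g (f x)) has_derivative (\<lambda>v. g' (f' v))) (at x within M)"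
  using has_derivative_in_compose[OF assms(1) has_derivative_subset[OF assms(2,3)]] .

text \<open>All invariant metrics below arise in one way: if a diffeomorphism \<open>H\<close> conjugates \<open>g\<close> to a
  linear isometry of the ambient space, then \<open>g\<close> preserves the metric that \<open>H\<close> pulls back from
  the Euclidean inner product.\<close>

abbreviation pullback_inner :: "'a::euclidean_space set \<Rightarrow> ('a \<Rightarrow> 'a) \<Rightarrow> 'a \<Rightarrow> 'a \<Rightarrow> 'a \<Rightarrow> real" where
  "pullback_inner M H \<equiv> pullback_metric M H (\<lambda>_. (\<bullet>))"

text \<open>The tangent map of the inverse diffeomorphism is a left inverse on tangent vectors, by the chain
  rule and the uniqueness of derivatives on tangent vectors.\<close>

lemma tangent_map_Diff_nonzero:
  assumes "H \<in> carrier (Diff M)" "x \<in> M" "v \<in> tangent_space M x" "v \<noteq> 0"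
  shows "tangent_map M H x v \<noteq> 0"
proof
  assume 0: "tangent_map M H x v = 0"
  note D = DiffD[OF assms(1)]
  let ?K = "inv_into M H"
  have K: "?K (H y) = y" if "y \<in> M" for y using D(2) that by (simp add: bij_betw_def inv_into_f_f)
  have HD: "(H has_derivative tangent_map M H x) (at x within M)"
    by (rule has_derivative_tangent_map[OF D(4) assms(2)])
  have KD: "(?K has_derivative tangent_map M ?K (H x)) (at (H x) within M)"
    by (rule has_derivative_tangent_map[OF D(5)]) (use D(3) assms(2) in blast)
  have comp: "((\<lambda>y. ?K (H y)) has_derivative (\<lambda>v. tangent_map M ?K (H x) (tangent_map M H x v))) (at x within M)"
    by (rule has_derivative_compose_within[OF HD KD]) (simp add: D(3))
  have "((\<lambda>y. ?K (H y)) has_derivative (\<lambda>v. v)) (at x within M)"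
    by (rule has_derivative_transform[OF assms(2) _ has_derivative_ident]) (rule K)
  then have "tangent_map M ?K (H x) (tangent_map M H x v) = v"
    by (rule derivative_unique_on_tangent_space[OF comp _ assms(3)])
  moreover have "tangent_map M ?K (H x) 0 = 0" by (rule linear_0[OF has_derivative_linear[OF KD]])
  ultimately show False using 0 assms(4) by simp
qed

text \<open>On tangent vectors the tangent map is the ambient derivative of any local extension, which can be
  applied to extensions of the vector fields.\<close>

lemma smooth_map_on_pullback_inner:
  assumes "smooth_map_on M H" "smooth_vector_field M X" "smooth_vector_field M Y"
  shows "smooth_map_on M (\<lambda>x. pullback_inner M H x (X x) (Y x))"
  unfolding smooth_map_on_iff
proof
  fix x assume x: "x \<in> M"
  obtain U F where F: "x \<in> U" "smooth_on F U" "\<forall>y\<in>M \<inter> U. F y = H y"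
    using assms(1) x unfolding smooth_map_on_iff by blast
  obtain V X' where X: "x \<in> V" "smooth_on X' V" "\<forall>y\<in>M \<inter> V. X' y = X y"
    using assms(2) x unfolding smooth_vector_field_def smooth_map_on_iff by blast
  obtain W Y' where Y: "x \<in> W" "smooth_on Y' W" "\<forall>y\<in>M \<inter> W. Y' y = Y y"
    using assms(3) x unfolding smooth_vector_field_def smooth_map_on_iff by blast
  let ?U = "U \<inter> V \<inter> W" and ?D = "\<lambda>y. frechet_derivative F (at y)"
  have U: "open ?U" using F(2) X(2) Y(2) by (simp add: smooth_on_def open_Int)
  have s: "smooth_on F ?U" "smooth_on X' ?U" "smooth_on Y' ?U"
    by (rule smooth_on_subset[OF F(2) _ U] smooth_on_subset[OF X(2) _ U] smooth_on_subset[OF Y(2) _ U]; blast)+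
  have "smooth_on (\<lambda>y. ?D y (X' y) \<bullet> ?D y (Y' y)) ?U"
    by (intro smooth_on_inner smooth_on_directional_derivative s)
  moreover have "\<forall>y\<in>M \<inter> ?U. ?D y (X' y) \<bullet> ?D y (Y' y) = pullback_inner M H y (X y) (Y y)"
  proof
    fix y assume y: "y \<in> M \<inter> ?U"
    have HD: "(H has_derivative ?D y) (at y within M)"
      by (rule has_derivative_of_local_extension[OF _ _ _ F(3) smooth_on_has_derivative[OF F(2)]])
        (use F(2) y in \<open>simp_all add: smooth_on_def\<close>)
    have "X y \<in> tangent_space M y" "Y y \<in> tangent_space M y" "X' y = X y" "Y' y = Y y"
      using assms(2,3) X(3) Y(3) y unfolding smooth_vector_field_def by blast+
    then show "?D y (X' y) \<bullet> ?D y (Y' y) = pullback_inner M H y (X y) (Y y)"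
      unfolding pullback_metric_def by (simp only: tangent_map_eqI[OF HD])
  qed
  ultimately show "\<exists>U F. x \<in> U \<and> smooth_on F U \<and> (\<forall>y\<in>M \<inter> U. F y = pullback_inner M H y (X y) (Y y))"
    using F(1) X(1) Y(1) by (intro exI[of _ ?U] exI[of _ "\<lambda>y. ?D y (X' y) \<bullet> ?D y (Y' y)"]) simp
qed

lemma riemannian_metric_pullback_inner:
  assumes "H \<in> carrier (Diff M)"
  shows "riemannian_metric M (pullback_inner M H)"
proof -
  have L: "linear (tangent_map M H x)" if "x \<in> M" for x
    using has_derivative_tangent_map[OF DiffD(4)[OF assms] that] has_derivative_linear by blast
  show ?thesis
    unfolding riemannian_metric_def
    using L tangent_map_Diff_nonzero[OF assms] smooth_map_on_pullback_inner[OF DiffD(4)[OF assms]]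
    by (simp add: pullback_metric_def linear_add linear_scale inner_add_left inner_add_right inner_commute)
qed

text \<open>Differentiating \<open>H \<circ> g = L \<circ> H\<close> gives two derivatives of the same map, which agree on tangent
  vectors; the isometry \<open>L\<close> then drops out of the inner product.\<close>

lemma preserves_pullback_inner:
  assumes "H \<in> carrier (Diff M)" "g \<in> carrier (Diff M)"
    and L: "bounded_linear L" "\<And>u v. L u \<bullet> L v = u \<bullet> v"
    and conj: "\<And>x. x \<in> M \<Longrightarrow> H (g x) = L (H x)"
  shows "preserves_metric M g (pullback_inner M H)"
proof -
  note H = DiffD[OF assms(1)] note G = DiffD[OF assms(2)]
  have "tangent_map M H (g x) (tangent_map M g x v) = L (tangent_map M H x v)"
    if x: "x \<in> M" and v: "v \<in> tangent_space M x" for x v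
  proof -
    have gx: "g x \<in> M" using G(3) x by blast
    have "((\<lambda>x. H (g x)) has_derivative (\<lambda>v. tangent_map M H (g x) (tangent_map M g x v))) (at x within M)"
      by (rule has_derivative_compose_within[OF has_derivative_tangent_map[OF G(4) x]
            has_derivative_tangent_map[OF H(4) gx]]) (simp add: G(3))
    moreover have "((\<lambda>x. H (g x)) has_derivative (\<lambda>v. L (tangent_map M H x v))) (at x within M)"
      by (rule has_derivative_transform[OF x _ bounded_linear.has_derivative[OF L(1) has_derivative_tangent_map[OF H(4) x]]])
        (rule conj)
    ultimately show ?thesis using derivative_unique_on_tangent_space v by blast
  qed
  then show ?thesis using L(2) by (simp add: preserves_metric_def pullback_metric_def)
qed

section \<open>Quaternions\<close>

definition quat :: "real \<Rightarrow> real \<Rightarrow> real \<Rightarrow> real \<Rightarrow> real^4" where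
  "quat a b c d = (\<chi> i. if i = 1 then a else if i = 2 then b else if i = 3 then c else d)"

lemma quat_nth [simp]:
  "quat a b c d $ 1 = a" "quat a b c d $ 2 = b" "quat a b c d $ 3 = c" "quat a b c d $ 4 = d"
  by (simp_all add: quat_def)

lemma quat_eq_iff: "x = y \<longleftrightarrow> x $ 1 = y $ 1 \<and> x $ 2 = y $ 2 \<and> x $ 3 = y $ 3 \<and> x $ 4 = y $ 4"
  for x y :: "real^4"
  by (simp add: vec_eq_iff forall_4)

lemma inner_quat: "x \<bullet> y = x $ 1 * y $ 1 + x $ 2 * y $ 2 + x $ 3 * y $ 3 + x $ 4 * y $ 4"
  for x y :: "real^4"
  by (simp add: inner_vec_def sum_4)

definition qmul :: "real^4 \<Rightarrow> real^4 \<Rightarrow> real^4" (infixl "\<star>" 70) where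
  "a \<star> x = quat
     (a $ 1 * x $ 1 - a $ 2 * x $ 2 - a $ 3 * x $ 3 - a $ 4 * x $ 4)
     (a $ 1 * x $ 2 + a $ 2 * x $ 1 + a $ 3 * x $ 4 - a $ 4 * x $ 3)
     (a $ 1 * x $ 3 - a $ 2 * x $ 4 + a $ 3 * x $ 1 + a $ 4 * x $ 2)
     (a $ 1 * x $ 4 + a $ 2 * x $ 3 - a $ 3 * x $ 2 + a $ 4 * x $ 1)"

definition qconj :: "real^4 \<Rightarrow> real^4" where
  "qconj a = quat (a $ 1) (- a $ 2) (- a $ 3) (- a $ 4)"

definition qone :: "real^4" where "qone = quat 1 0 0 0"

lemmas quat_simps = quat_eq_iff inner_quat qmul_def qconj_def qone_def

lemma qmul_assoc: "a \<star> b \<star> c = a \<star> (b \<star> c)"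
  by (simp add: quat_simps algebra_simps)

lemma qmul_one [simp]: "qone \<star> a = a" "a \<star> qone = a"
  by (simp_all add: quat_simps)

lemma bilinear_qmul: "bilinear (\<star>)"
  unfolding bilinear_def by (auto intro!: linearI simp: quat_simps algebra_simps)

lemma bounded_bilinear_qmul: "bounded_bilinear (\<star>)"
  using bilinear_conv_bounded_bilinear bilinear_qmul by blast

lemmas qmul_linear_simps =
  bilinear_ladd[OF bilinear_qmul] bilinear_radd[OF bilinear_qmul]
  bilinear_lsub[OF bilinear_qmul] bilinear_rsub[OF bilinear_qmul]
  bilinear_lmul[OF bilinear_qmul] bilinear_rmul[OF bilinear_qmul]
  bilinear_lneg[OF bilinear_qmul] bilinear_rneg[OF bilinear_qmul]
  bilinear_lzero[OF bilinear_qmul] bilinear_rzero[OF bilinear_qmul]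

lemma qconj_qconj [simp]: "qconj (qconj a) = a"
  by (simp add: quat_simps)

lemma qconj_one [simp]: "qconj qone = qone"
  by (simp add: quat_simps)

lemma qconj_mult: "qconj (a \<star> b) = qconj b \<star> qconj a"
  by (simp add: quat_simps)

lemma norm_qconj [simp]: "norm (qconj a) = norm a"
  by (simp add: norm_eq_sqrt_inner quat_simps)

lemma norm_qone [simp]: "norm qone = 1"
  by (simp add: norm_eq_sqrt_inner quat_simps)

lemma qmul_qconj: "a \<star> qconj a = (a \<bullet> a) *\<^sub>R qone" "qconj a \<star> a = (a \<bullet> a) *\<^sub>R qone"
  by (simp_all add: quat_simps)

lemma inner_qmul_qmul: "(a \<star> x) \<bullet> (a \<star> y) = (a \<bullet> a) * (x \<bullet> y)"
  by (simp add: quat_simps) algebra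

lemma norm_qmul: "norm (a \<star> x) = norm a * norm x"
  by (simp add: norm_eq_sqrt_inner inner_qmul_qmul real_sqrt_mult)

lemma inner_qmul_right: "s \<bullet> (a \<star> x) = (qconj a \<star> s) \<bullet> x"
  by (simp add: quat_simps algebra_simps)

lemma unit_qmul_qconj [simp]:
  assumes "norm a = 1"
  shows "a \<star> qconj a = qone" "qconj a \<star> a = qone" "a \<star> (qconj a \<star> x) = x" "qconj a \<star> (a \<star> x) = x"
  using assms by (simp_all add: qmul_qconj norm_eq_1 flip: qmul_assoc)

text \<open>Since the quaternions form a division algebra, left translation by a quaternion other than 1 has no
  eigenvalue 1. Hence every cocycle over a single nontrivial translation of the sphere that is
  given by linear functions is the coboundary of a linear function.\<close>

lemma unit_quat_coboundary:
  assumes "a \<noteq> qone"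
  obtains u where "t = qconj a \<star> u - u"
proof -
  define q where "q = qconj a - qone"
  have "q \<noteq> 0" using assms qconj_qconj[of a] qconj_one unfolding q_def by (metis eq_iff_diff_eq_0)
  then have "q \<star> (inverse (q \<bullet> q) *\<^sub>R (qconj q \<star> t)) = t"
    by (simp add: qmul_linear_simps qmul_qconj flip: qmul_assoc)
  moreover have "q \<star> w = qconj a \<star> w - w" for w by (simp add: q_def qmul_linear_simps)
  ultimately show thesis using that by metis
qed

section \<open>A hyperbolic flow on the circle\<close>

text \<open>In the stereographic coordinate \<open>q / (1 + p)\<close> of the point \<open>(p, q)\<close> of the circle the flow is
  multiplication by \<open>e\<^sup>-\<^sup>t\<close>. Expressed through \<open>p\<close> and \<open>q\<close> this is a rational formula without
  square roots, so that it is smooth on a neighbourhood of the circle in the plane.\<close>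

definition flow_denom :: "real \<Rightarrow> real \<Rightarrow> real" where
  "flow_denom t p = exp t * (1 + p) + exp (- t) * (1 - p)"

definition flow :: "real \<Rightarrow> real^2 \<Rightarrow> real^2" where
  "flow t \<theta> = inverse (flow_denom t (\<theta> $ 1)) *\<^sub>R
     ((exp t * (1 + \<theta> $ 1) - exp (- t) * (1 - \<theta> $ 1)) *\<^sub>R axis 1 1 + (2 * \<theta> $ 2) *\<^sub>R axis 2 1)"

lemma vec2_eq_iff: "x = y \<longleftrightarrow> x $ 1 = y $ 1 \<and> x $ 2 = y $ 2" for x y :: "real^2"
  by (simp add: vec_eq_iff forall_2)

lemma norm_vec2_eq_1_iff: "norm \<theta> = 1 \<longleftrightarrow> (\<theta> $ 1)\<^sup>2 + (\<theta> $ 2)\<^sup>2 = 1" for \<theta> :: "real^2"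
  by (simp add: norm_eq_1 inner_vec_def sum_2 power2_eq_square)

lemma flow_nth [simp]:
  "flow t \<theta> $ 1 = (exp t * (1 + \<theta> $ 1) - exp (- t) * (1 - \<theta> $ 1)) / flow_denom t (\<theta> $ 1)"
  "flow t \<theta> $ 2 = 2 * \<theta> $ 2 / flow_denom t (\<theta> $ 1)"
  by (simp_all add: flow_def axis_def divide_inverse)

lemma flow_denom_pos:
  assumes "norm \<theta> = 1"
  shows "flow_denom t (\<theta> $ 1) > 0"
proof -
  have "\<bar>\<theta> $ 1\<bar> \<le> 1" using component_le_norm_cart[of \<theta> 1] assms by simp
  then have "(0 \<le> 1 + \<theta> $ 1 \<and> 0 < 1 - \<theta> $ 1) \<or> (0 < 1 + \<theta> $ 1 \<and> 0 \<le> 1 - \<theta> $ 1)" by linarith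
  then show ?thesis
    unfolding flow_denom_def by (auto intro: add_nonneg_pos add_pos_nonneg)
qed

lemma flow_0: "norm \<theta> = 1 \<Longrightarrow> flow 0 \<theta> = \<theta>"
  by (simp add: vec2_eq_iff flow_denom_def)

text \<open>The quantities \<open>1 + p\<close> and \<open>1 - p\<close> are homogeneous coordinates of the first component on which the
  flow acts diagonally; from this the flow equation and the invariance of the circle follow.\<close>

lemma one_plus_minus_flow:
  assumes "norm \<theta> = 1"
  shows "1 + flow t \<theta> $ 1 = 2 * exp t * (1 + \<theta> $ 1) / flow_denom t (\<theta> $ 1)"
    and "1 - flow t \<theta> $ 1 = 2 * exp (- t) * (1 - \<theta> $ 1) / flow_denom t (\<theta> $ 1)"
  using flow_denom_pos[OF assms, of t] by (simp_all add: field_simps) (simp_all add: flow_denom_def field_simps)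

lemma norm_flow:
  assumes "norm \<theta> = 1"
  shows "norm (flow t \<theta>) = 1"
proof -
  let ?D = "flow_denom t (\<theta> $ 1)"
  have "exp t * exp (- t) = (1::real)" by (simp flip: exp_add)
  then have "(1 + flow t \<theta> $ 1) * (1 - flow t \<theta> $ 1) = 4 * ((1 + \<theta> $ 1) * (1 - \<theta> $ 1)) / ?D\<^sup>2"
    unfolding one_plus_minus_flow[OF assms] by (simp add: power2_eq_square)
  also have "(1 + \<theta> $ 1) * (1 - \<theta> $ 1) = (\<theta> $ 2)\<^sup>2"
    using assms by (simp add: norm_vec2_eq_1_iff algebra_simps power2_eq_square)
  also have "4 * (\<theta> $ 2)\<^sup>2 / ?D\<^sup>2 = (flow t \<theta> $ 2)\<^sup>2"
    by (simp add: power_divide power_mult_distrib)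
  finally show ?thesis by (simp add: norm_vec2_eq_1_iff algebra_simps power2_eq_square)
qed

lemma flow_flow:
  assumes "norm \<theta> = 1"
  shows "flow s (flow t \<theta>) = flow (s + t) \<theta>"
proof -
  let ?D = "flow_denom t (\<theta> $ 1)"
  note pos = flow_denom_pos[OF assms, of t] flow_denom_pos[OF assms, of "s + t"]
  have e: "exp (s + t) = exp s * exp t" "exp (- (s + t)) = exp (- s) * exp (- t)"
    by (simp_all flip: exp_add)
  have D: "flow_denom s (flow t \<theta> $ 1) = 2 * flow_denom (s + t) (\<theta> $ 1) / ?D"
    unfolding flow_denom_def[of s] one_plus_minus_flow[OF assms] flow_denom_def[of "s + t"] e
    using pos(1) by (simp add: field_simps)
  have N: "exp s * (1 + flow t \<theta> $ 1) - exp (- s) * (1 - flow t \<theta> $ 1) =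
      2 * (exp (s + t) * (1 + \<theta> $ 1) - exp (- (s + t)) * (1 - \<theta> $ 1)) / ?D"
    unfolding one_plus_minus_flow[OF assms] e using pos(1) by (simp add: field_simps)
  have cancel: "2 * n / ?D / (2 * d / ?D) = n / d" for n d
    using pos(1) by (simp add: field_simps)
  have "flow s (flow t \<theta>) $ 1 = flow (s + t) \<theta> $ 1"
    unfolding flow_nth(1)[of s] D N cancel by simp
  moreover have "flow s (flow t \<theta>) $ 2 = flow (s + t) \<theta> $ 2"
    unfolding flow_nth(2)[of s] D using pos by simp
  ultimately show ?thesis by (simp add: vec2_eq_iff)
qed

section \<open>Skew products over translations of the three-sphere\<close>

text \<open>A pair \<open>(a, t)\<close> translates the three-sphere by \<open>a\<close> and moves the circle over \<open>x\<close> by the flow for the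
  time \<open>t \<bullet> x\<close>. Such maps are closed under composition because a translation carries a linear
  function of \<open>x\<close> to a linear function; the composition law on pairs is that of a semidirect
  product of the unit quaternions with the translations of \<open>\<real>\<^sup>4\<close>.\<close>

fun skew :: "(real^4) \<times> (real^4) \<Rightarrow> (real^4) \<times> (real^2) \<Rightarrow> (real^4) \<times> (real^2)" where
  "skew (a, t) (x, \<theta>) = (a \<star> x, flow (t \<bullet> x) \<theta>)"

fun skew_comp :: "(real^4) \<times> (real^4) \<Rightarrow> (real^4) \<times> (real^4) \<Rightarrow> (real^4) \<times> (real^4)" where
  "skew_comp (b, s) (a, t) = (b \<star> a, t + qconj a \<star> s)"

fun skew_inv :: "(real^4) \<times> (real^4) \<Rightarrow> (real^4) \<times> (real^4)" where
  "skew_inv (a, t) = (qconj a, - (a \<star> t))"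

lemma S3xS1_iff: "(x, \<theta>) \<in> S3xS1 \<longleftrightarrow> norm x = 1 \<and> norm \<theta> = 1"
  by (simp add: S3xS1_def)

lemma skew_in_S3xS1: "norm (fst k) = 1 \<Longrightarrow> p \<in> S3xS1 \<Longrightarrow> skew k p \<in> S3xS1"
  by (cases k; cases p) (simp add: S3xS1_iff norm_qmul norm_flow)

lemma skew_skew: "p \<in> S3xS1 \<Longrightarrow> skew k (skew l p) = skew (skew_comp k l) p"
  by (cases k; cases l; cases p)
    (simp add: S3xS1_iff flow_flow qmul_assoc inner_qmul_right inner_add_left add.commute)

lemma skew_id: "p \<in> S3xS1 \<Longrightarrow> skew (qone, 0) p = p"
  by (cases p) (simp add: S3xS1_iff flow_0)

lemma skew_comp_inv:
  "norm (fst k) = 1 \<Longrightarrow> skew_comp k (skew_inv k) = (qone, 0)"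
  "norm (fst k) = 1 \<Longrightarrow> skew_comp (skew_inv k) k = (qone, 0)"
  by (cases k; simp add: qmul_linear_simps)+

lemma smooth_on_flow_denom:
  assumes "smooth_on f U" "smooth_on g U"
  shows "smooth_on (\<lambda>p. flow_denom (f p) (g p)) U"
proof -
  have "smooth_on (\<lambda>p. 1) U" using assms smooth_on_const by (simp add: smooth_on_def Ck_on_const)
  then show ?thesis
    unfolding flow_denom_def
    by (intro smooth_on_add smooth_on_diff smooth_on_mult smooth_on_exp smooth_on_minus assms)
qed

lemma smooth_on_skew:
  "smooth_on (skew (a, t)) {p. flow_denom (t \<bullet> fst p) (snd p $ 1) \<noteq> 0}" (is "smooth_on _ ?U")
proof -
  have "open ?U"
    unfolding flow_denom_def by (intro open_Collect_neq continuous_intros)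
  note c = smooth_on_const[OF this] and i = smooth_on_ident[OF this]
  have x: "smooth_on fst ?U" and th: "smooth_on (\<lambda>p. snd p $ j) ?U" for j
    using smooth_on_bounded_linear[OF bounded_linear_fst i]
      smooth_on_bounded_linear[OF bounded_linear_compose[OF bounded_linear_vec_nth[of j] bounded_linear_snd] i]
    by simp_all
  have "smooth_on (\<lambda>p. (a \<star> fst p, flow (t \<bullet> fst p) (snd p))) ?U"
    unfolding flow_def
    by (intro smooth_on_Pair smooth_on_flow_denom smooth_on_bounded_bilinear[OF bounded_bilinear_qmul] smooth_on_scaleR smooth_on_inverse
        smooth_on_add smooth_on_diff smooth_on_mult smooth_on_exp smooth_on_inner smooth_on_minus c x th)
      simp
  moreover have "skew (a, t) = (\<lambda>p. (a \<star> fst p, flow (t \<bullet> fst p) (snd p)))"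
    by (auto simp: fun_eq_iff)
  ultimately show ?thesis by simp
qed

lemma smooth_map_on_skew: "smooth_map_on S3xS1 (skew k)"
proof (cases k)
  case (Pair a t)
  show ?thesis
    unfolding Pair
  proof (rule smooth_map_on_of_smooth_on[OF smooth_on_skew])
    show "S3xS1 \<subseteq> {p. flow_denom (t \<bullet> fst p) (snd p $ 1) \<noteq> 0}"
      by (auto simp: S3xS1_iff flow_denom_pos[THEN less_imp_neq, THEN not_sym])
  qed simp
qed

definition skew_diffeo :: "(real^4) \<times> (real^4) \<Rightarrow> (real^4) \<times> (real^2) \<Rightarrow> (real^4) \<times> (real^2)" where
  "skew_diffeo k = restrict (skew k) S3xS1"

lemma skew_diffeo_in_Diff:
  assumes "norm (fst k) = 1"
  shows "skew_diffeo k \<in> carrier (Diff S3xS1)"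
  unfolding skew_diffeo_def
proof (rule restrict_in_Diff[OF smooth_map_on_skew smooth_map_on_skew])
  have inv: "norm (fst (skew_inv k)) = 1" using assms by (cases k) simp
  show "skew k p \<in> S3xS1" "skew (skew_inv k) p \<in> S3xS1"
    "skew (skew_inv k) (skew k p) = p" "skew k (skew (skew_inv k) p) = p" if "p \<in> S3xS1" for p
    using that assms inv by (simp_all add: skew_in_S3xS1 skew_skew skew_comp_inv skew_id)
qed

lemma skew_diffeo_comp:
  assumes "norm (fst k) = 1" "norm (fst l) = 1"
  shows "skew_diffeo k \<otimes>\<^bsub>Diff S3xS1\<^esub> skew_diffeo l = skew_diffeo (skew_comp k l)"
  using assms
  by (simp add: Diff_simps(3) skew_diffeo_in_Diff)
    (simp add: skew_diffeo_def compose_def fun_eq_iff skew_in_S3xS1 skew_skew)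

text \<open>If the cocycle is the coboundary of \<open>u\<close>, then sliding the circle over \<open>x\<close> by the flow for the time
  \<open>- (u \<bullet> x)\<close> conjugates the skew product to the product of a translation of the sphere and the identity,
  which is an isometry.\<close>

lemma skew_coboundary_preserves_metric:
  assumes "norm a = 1"
  shows "\<exists>m. riemannian_metric S3xS1 m \<and> preserves_metric S3xS1 (skew_diffeo (a, qconj a \<star> u - u)) m"
proof (intro exI conjI)
  let ?H = "skew_diffeo (qone, - u)" and ?g = "skew_diffeo (a, qconj a \<star> u - u)"
  let ?L = "\<lambda>p::(real^4) \<times> (real^2). (a \<star> fst p, snd p)"
  have H: "?H \<in> carrier (Diff S3xS1)" by (simp add: skew_diffeo_in_Diff)
  then show "riemannian_metric S3xS1 (pullback_inner S3xS1 ?H)" by (rule riemannian_metric_pullback_inner)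
  show "preserves_metric S3xS1 ?g (pullback_inner S3xS1 ?H)"
  proof (rule preserves_pullback_inner[OF H, where L="?L"])
    show "?g \<in> carrier (Diff S3xS1)" using assms by (simp add: skew_diffeo_in_Diff)
    show "bounded_linear ?L"
      by (intro bounded_linear_Pair bounded_linear_snd bounded_linear_compose[OF _ bounded_linear_fst]
          bounded_bilinear.bounded_linear_right[OF bounded_bilinear_qmul])
    show "?L p \<bullet> ?L q = p \<bullet> q" for p q
      using assms by (simp add: inner_prod_def inner_qmul_qmul norm_eq_1)
    show "?H (?g p) = ?L (?H p)" if "p \<in> S3xS1" for p
      using that assms skew_in_S3xS1[OF _ that, of "(a, qconj a \<star> u - u)"]
      by (cases p) (simp add: skew_diffeo_def skew_skew del: skew.simps, simp add: qmul_linear_simps)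
  qed
qed

section \<open>Derivatives of skew products along the fibres\<close>

definition quarter_turn :: "real^2 \<Rightarrow> real^2" where
  "quarter_turn \<theta> = - (\<theta> $ 2) *\<^sub>R axis 1 1 + (\<theta> $ 1) *\<^sub>R axis 2 1"

text \<open>The unit vector field along the circles is globally defined and smooth, so that an arbitrary metric
  can be evaluated on it and bounded by compactness.\<close>

definition fibre_field :: "(real^4) \<times> (real^2) \<Rightarrow> (real^4) \<times> (real^2)" where
  "fibre_field p = (0, quarter_turn (snd p))"

text \<open>Tangent vectors are velocities of curves. The speed \<open>c\<close> exhibits the multiples of the fibre field as
  tangent vectors, as the homogeneity of a metric is a statement on tangent vectors only.\<close>

definition fibre_curve :: "(real^4) \<times> (real^2) \<Rightarrow> real \<Rightarrow> real \<Rightarrow> (real^4) \<times> (real^2)" where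
  "fibre_curve p c s = (fst p, cos (c * s) *\<^sub>R snd p + sin (c * s) *\<^sub>R quarter_turn (snd p))"

lemma quarter_turn_nth [simp]:
  "quarter_turn \<theta> $ 1 = - \<theta> $ 2" "quarter_turn \<theta> $ 2 = \<theta> $ 1"
  by (simp_all add: quarter_turn_def axis_def)

lemma fibre_curve_in_S3xS1:
  assumes "p \<in> S3xS1"
  shows "fibre_curve p c s \<in> S3xS1"
proof -
  obtain x \<theta> where p: "p = (x, \<theta>)" by (cases p)
  let ?C = "cos (c * s)" and ?S = "sin (c * s)"
  have 1: "(\<theta> $ 1)\<^sup>2 + (\<theta> $ 2)\<^sup>2 = 1" using assms by (simp add: p S3xS1_iff norm_vec2_eq_1_iff)
  have "(?C * \<theta> $ 1 - ?S * \<theta> $ 2)\<^sup>2 + (?C * \<theta> $ 2 + ?S * \<theta> $ 1)\<^sup>2 =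
      (?S\<^sup>2 + ?C\<^sup>2) * ((\<theta> $ 1)\<^sup>2 + (\<theta> $ 2)\<^sup>2)"
    by algebra
  then show ?thesis
    using assms 1 by (simp add: p fibre_curve_def S3xS1_iff norm_vec2_eq_1_iff)
qed

lemma fibre_curve_0 [simp]: "fibre_curve p c 0 = p"
  by (simp add: fibre_curve_def)

lemma fibre_curve_has_derivative:
  "(fibre_curve p c has_vector_derivative c *\<^sub>R fibre_field p) (at 0)"
proof -
  have "(fibre_curve p c has_derivative (\<lambda>s. (0, (s * c) *\<^sub>R quarter_turn (snd p)))) (at 0)"
    unfolding fibre_curve_def
    by (auto intro!: derivative_eq_intros simp: mult.commute)
  then show ?thesis
    by (simp add: has_vector_derivative_def fibre_field_def scaleR_prod_def)
qed

lemma smooth_on_fibre_curve: "smooth_on (fibre_curve p c) UNIV"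
  unfolding fibre_curve_def
  by (intro smooth_on_Pair smooth_on_add smooth_on_scaleR smooth_on_cos smooth_on_sin smooth_on_mult
      smooth_on_const smooth_on_ident open_UNIV)

lemma fibre_vector_tangent:
  assumes "p \<in> S3xS1"
  shows "c *\<^sub>R fibre_field p \<in> tangent_space S3xS1 p"
  unfolding tangent_space_def
proof (intro CollectI exI[of _ "fibre_curve p c"] exI[of _ 1] conjI)
  show "\<forall>k. Ck_on k (fibre_curve p c) {-1<..<1}"
    using smooth_on_fibre_curve[of p c] Ck_on_subset unfolding smooth_on_def by blast
  show "fibre_curve p c ` {- 1<..<1} \<subseteq> S3xS1" using fibre_curve_in_S3xS1[OF assms] by blast
qed (simp_all add: fibre_curve_has_derivative)

lemma smooth_vector_field_fibre_field: "smooth_vector_field S3xS1 fibre_field"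
proof -
  have "bounded_linear fibre_field"
    unfolding fibre_field_def quarter_turn_def
    by (intro bounded_linear_Pair bounded_linear_zero bounded_linear_add bounded_linear_scaleR_const
        bounded_linear_minus bounded_linear_compose[OF bounded_linear_vec_nth bounded_linear_snd])
  then have "smooth_on fibre_field UNIV"
    using smooth_on_bounded_linear[OF _ smooth_on_ident[OF open_UNIV]] by blast
  then have "smooth_map_on S3xS1 fibre_field" by (rule smooth_map_on_of_smooth_on) auto
  moreover have "fibre_field p \<in> tangent_space S3xS1 p" if "p \<in> S3xS1" for p
    using fibre_vector_tangent[OF that, of 1] by simp
  ultimately show ?thesis by (simp add: smooth_vector_field_def)
qed

lemma fibre_field_nonzero: "p \<in> S3xS1 \<Longrightarrow> fibre_field p \<noteq> 0"
  by (cases p) (auto simp: fibre_field_def S3xS1_iff norm_vec2_eq_1_iff vec2_eq_iff zero_prod_def)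

text \<open>The point \<open>(1, 0)\<close> of the circle is a fixed point of the flow, with multiplier \<open>e\<^sup>-\<^sup>t\<close>. The sphere
  over it is therefore invariant under all skew products, and on it the fibre derivative of the pair
  \<open>(a, t)\<close> is \<open>e\<close> to the power \<open>- (t \<bullet> x)\<close>.\<close>

abbreviation pole :: "real^2" where "pole \<equiv> axis 1 1"

lemma pole_in_S3xS1: "norm x = 1 \<Longrightarrow> (x, pole) \<in> S3xS1"
  by (simp add: S3xS1_iff)

lemma skew_pole: "skew (a, t) (x, pole) = (a \<star> x, pole)"
  by (simp add: vec2_eq_iff flow_denom_def axis_def)

lemma flow_derivative_pole:
  "((\<lambda>s. flow t (cos s *\<^sub>R pole + sin s *\<^sub>R quarter_turn pole)) has_vector_derivative
     exp (- t) *\<^sub>R quarter_turn pole) (at 0)"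
proof -
  let ?D = "\<lambda>s. flow_denom t (cos s)"
  have D: "(?D has_real_derivative 0) (at 0)"
    unfolding flow_denom_def by (auto intro!: derivative_eq_intros)
  have D0: "?D 0 = 2 * exp t" by (simp add: flow_denom_def)
  have d1: "((\<lambda>s. inverse (?D s) * (exp t * (1 + cos s) - exp (- t) * (1 - cos s))) has_real_derivative 0) (at 0)"
    using D0 by (auto intro!: derivative_eq_intros D)
  have d2: "((\<lambda>s. inverse (?D s) * (2 * sin s)) has_real_derivative exp (- t)) (at 0)"
    using D0 by (auto intro!: derivative_eq_intros D simp: exp_minus)
  have "((\<lambda>s. (inverse (?D s) * (exp t * (1 + cos s) - exp (- t) * (1 - cos s))) *\<^sub>R axis 1 1 +
      (inverse (?D s) * (2 * sin s)) *\<^sub>R axis 2 1 :: real^2) has_vector_derivative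
      0 *\<^sub>R axis 1 1 + exp (- t) *\<^sub>R axis 2 1) (at 0)"
    by (intro has_vector_derivative_add 
        bounded_linear.has_vector_derivative[OF bounded_linear_scaleR_left]
        d1[unfolded has_real_derivative_iff_has_vector_derivative]
        d2[unfolded has_real_derivative_iff_has_vector_derivative])
  then show ?thesis
    by (simp add: flow_def scaleR_add_right axis_def quarter_turn_def)
qed

lemma tangent_map_skew_pole:
  assumes "norm x = 1"
  shows "tangent_map S3xS1 (skew_diffeo (a, t)) (x, pole) (fibre_field (x, pole)) =
    exp (- (t \<bullet> x)) *\<^sub>R fibre_field (a \<star> x, pole)"
proof -
  let ?p = "(x, pole)" and ?g = "skew_diffeo (a, t)" and ?\<gamma> = "fibre_curve (x, pole) 1"
  note p = pole_in_S3xS1[OF assms]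
  have "smooth_map_on S3xS1 ?g"
    by (rule smooth_map_on_cong[OF smooth_map_on_skew]) (simp add: skew_diffeo_def)
  then have D: "(?g has_derivative tangent_map S3xS1 ?g ?p) (at ?p within S3xS1)"
    using has_derivative_tangent_map p by blast
  have "((\<lambda>s. ?g (?\<gamma> s)) has_vector_derivative tangent_map S3xS1 ?g ?p (1 *\<^sub>R fibre_field ?p)) (at 0)"
    by (rule has_vector_derivative_along_curve[OF D, where \<epsilon>=1])
      (use fibre_curve_in_S3xS1[OF p] fibre_curve_has_derivative[of ?p 1] in auto)
  moreover have "((\<lambda>s. ?g (?\<gamma> s)) has_vector_derivative exp (- (t \<bullet> x)) *\<^sub>R fibre_field (a \<star> x, pole)) (at 0)"
  proof -
    have "?g (?\<gamma> s) = (a \<star> x, flow (t \<bullet> x) (cos s *\<^sub>R pole + sin s *\<^sub>R quarter_turn pole))" for s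
      using fibre_curve_in_S3xS1[OF p, of 1 s] by (simp add: skew_diffeo_def fibre_curve_def)
    then show ?thesis
      using has_vector_derivative_Pair[OF has_vector_derivative_const flow_derivative_pole]
      by (simp add: fibre_field_def scaleR_prod_def)
  qed
  ultimately show ?thesis using vector_derivative_unique_at by fastforce
qed

lemma riemannian_metric_fibre_bounds:
  assumes "riemannian_metric S3xS1 h"
  obtains l u where "0 < l" "l \<le> u"
    "\<And>p. p \<in> S3xS1 \<Longrightarrow> l \<le> metric_norm h p (fibre_field p) \<and> metric_norm h p (fibre_field p) \<le> u"
proof -
  let ?f = "\<lambda>p. metric_norm h p (fibre_field p)"
  have "smooth_map_on S3xS1 (\<lambda>p. h p (fibre_field p) (fibre_field p))"
    using assms smooth_vector_field_fibre_field unfolding riemannian_metric_def by blast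
  then have cont: "continuous_on S3xS1 ?f"
    unfolding metric_norm_def by (intro continuous_on_real_sqrt smooth_map_on_imp_continuous_on)
  have comp: "compact (S3xS1)" unfolding S3xS1_def by (intro compact_Times) simp_all
  have ne: "S3xS1 \<noteq> {}" using pole_in_S3xS1[OF norm_qone] by blast
  obtain p where p: "p \<in> S3xS1" "\<forall>y\<in>S3xS1. ?f p \<le> ?f y"
    using continuous_attains_inf[OF comp ne cont] by blast
  obtain q where q: "q \<in> S3xS1" "\<forall>y\<in>S3xS1. ?f y \<le> ?f q"
    using continuous_attains_sup[OF comp ne cont] by blast
  have "fibre_field p \<in> tangent_space S3xS1 p" using fibre_vector_tangent[OF p(1), of 1] by simp
  then have "h p (fibre_field p) (fibre_field p) > 0"
    using assms p(1) fibre_field_nonzero unfolding riemannian_metric_def by blast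
  then have "0 < ?f p" by (simp add: metric_norm_def)
  then show thesis using that[of "?f p" "?f q"] p q by blast
qed

lemma metric_norm_scale_fibre:
  assumes "riemannian_metric S3xS1 h" "p \<in> S3xS1" "c \<ge> 0"
  shows "metric_norm h p (c *\<^sub>R fibre_field p) = c * metric_norm h p (fibre_field p)"
proof -
  let ?v = "fibre_field p"
  have v: "?v \<in> tangent_space S3xS1 p" "c *\<^sub>R ?v \<in> tangent_space S3xS1 p"
    using fibre_vector_tangent[OF assms(2), of 1] fibre_vector_tangent[OF assms(2), of c] by simp_all
  have "h p (c *\<^sub>R ?v) (c *\<^sub>R ?v) = c * h p ?v (c *\<^sub>R ?v)"
    using assms(1,2) v unfolding riemannian_metric_def by blast
  also have "h p ?v (c *\<^sub>R ?v) = h p (c *\<^sub>R ?v) ?v"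
    using assms(1,2) v unfolding riemannian_metric_def by blast
  also have "\<dots> = c * h p ?v ?v"
    using assms(1,2) v unfolding riemannian_metric_def by blast
  finally show ?thesis using assms(3) by (simp add: metric_norm_def real_sqrt_mult)
qed

text \<open>Over the fixed point \<open>(1, 0)\<close> and the unit vector opposite to \<open>t\<close> the fibre is expanded by the
  factor \<open>e\<close> to the power \<open>norm t\<close>. The constant only accounts for the variation of the length of the
  fibre field in the given metric.\<close>

lemma derivative_norm_skew_lower_bound:
  assumes "riemannian_metric S3xS1 h"
  obtains c where "c > 0"
    "\<And>a t. norm a = 1 \<Longrightarrow> ereal (c * exp (norm t)) \<le> derivative_norm S3xS1 h (skew_diffeo (a, t))"
proof -
  obtain l u where lu: "0 < l" "l \<le> u"
    and b: "\<And>p. p \<in> S3xS1 \<Longrightarrow> l \<le> metric_norm h p (fibre_field p) \<and> metric_norm h p (fibre_field p) \<le> u"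
    using riemannian_metric_fibre_bounds[OF assms] by metis
  show thesis
  proof (rule that[of "l / u"])
    show "l / u > 0" using lu by simp
    fix a t :: "real^4" assume a: "norm a = 1"
    obtain x :: "real^4" where x: "norm x = 1" "- (t \<bullet> x) = norm t"
    proof (cases "t = 0")
      case True
      then show ?thesis using that[of qone] by simp
    next
      case False
      then show ?thesis using that[of "- (t /\<^sub>R norm t)"]
        by (simp add: dot_square_norm power2_eq_square)
    qed
    let ?p = "(x, pole)" and ?q = "(a \<star> x, pole)" and ?g = "skew_diffeo (a, t)"
    have p: "?p \<in> S3xS1" and q: "?q \<in> S3xS1" using x a by (simp_all add: pole_in_S3xS1 norm_qmul)
    have gp: "?g ?p = ?q" using p skew_pole by (simp add: skew_diffeo_def del: skew.simps)
    have v: "fibre_field ?p \<in> tangent_space S3xS1 ?p - {0}"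
      using fibre_vector_tangent[OF p, of 1] fibre_field_nonzero[OF p] by simp
    have "l / u \<le> metric_norm h ?q (fibre_field ?q) / metric_norm h ?p (fibre_field ?p)"
      using b[OF p] b[OF q] lu by (intro frac_le) auto
    then have "l / u * exp (norm t) \<le> metric_norm h ?q (fibre_field ?q) / metric_norm h ?p (fibre_field ?p) * exp (norm t)"
      by (rule mult_right_mono) simp
    also have "\<dots> = metric_norm h (?g ?p) (tangent_map S3xS1 ?g ?p (fibre_field ?p)) / metric_norm h ?p (fibre_field ?p)"
      unfolding tangent_map_skew_pole[OF x(1)] gp x(2) by (simp add: metric_norm_scale_fibre[OF assms q])
    finally have "ereal (l / u * exp (norm t)) \<le> tangent_map_norm S3xS1 h ?g ?p"
      unfolding tangent_map_norm_def by (intro SUP_upper2[OF v]) simp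
    also have "\<dots> \<le> derivative_norm S3xS1 h ?g"
      unfolding derivative_norm_def by (intro SUP_upper2[OF p]) simp
    finally show "ereal (l / u * exp (norm t)) \<le> derivative_norm S3xS1 h ?g" .
  qed
qed

section \<open>A free group of unit quaternions\<close>

datatype imag_axis = Axis_i | Axis_j | Axis_k

type_synonym letter = "imag_axis \<times> bool"

fun inv_letter :: "letter \<Rightarrow> letter" where
  "inv_letter (a, s) = (a, \<not> s)"

fun imag_unit :: "letter \<Rightarrow> real^4" where
  "imag_unit (Axis_i, s) = quat 0 (if s then 1 else - 1) 0 0"
| "imag_unit (Axis_j, s) = quat 0 0 (if s then 1 else - 1) 0"
| "imag_unit (Axis_k, s) = quat 0 0 0 (if s then 1 else - 1)"

text \<open>The six quaternions \<open>3 \<plusminus> 4 i\<close>, \<open>3 \<plusminus> 4 j\<close>, \<open>3 \<plusminus> 4 k\<close> have integral coefficients and norm 5. After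
  division by 5 they become three unit quaternions and their inverses. That these are free
  generators is a consequence of arithmetic modulo 5.\<close>

definition int_rot :: "letter \<Rightarrow> real^4" where
  "int_rot l = 3 *\<^sub>R qone + 4 *\<^sub>R imag_unit l"

definition rot :: "letter \<Rightarrow> real^4" where
  "rot l = (1 / 5) *\<^sub>R int_rot l"

text \<open>The cocycle of each generator is the coboundary of its center and of no other vector. As the three
  centers differ, there is no common primitive. They are chosen with sum zero, which makes
  the translation parts of the six letters surround the origin.\<close>

fun center :: "imag_axis \<Rightarrow> real^4" where
  "center Axis_i = quat 1 0 0 0"
| "center Axis_j = quat 0 1 0 0"
| "center Axis_k = quat (- 1) (- 1) 0 0"

definition gen :: "letter \<Rightarrow> (real^4) \<times> (real^4)" where
  "gen l = (rot l, qconj (rot l) \<star> center (fst l) - center (fst l))"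

fun motion :: "letter list \<Rightarrow> (real^4) \<times> (real^4)" where
  "motion [] = (qone, 0)"
| "motion (l # w) = skew_comp (gen l) (motion w)"

lemma letter_cases:
  obtains "l = (Axis_i, True)" | "l = (Axis_i, False)" | "l = (Axis_j, True)" | "l = (Axis_j, False)"
  | "l = (Axis_k, True)" | "l = (Axis_k, False)"
  by (cases l; cases "fst l"; cases "snd l") auto

lemma qconj_rot: "qconj (rot l) = rot (inv_letter l)"
  by (cases l rule: letter_cases) (simp_all add: rot_def int_rot_def quat_simps)

lemma inner_int_rot: "int_rot l \<bullet> int_rot l = 25"
  by (cases l rule: letter_cases) (simp_all add: int_rot_def quat_simps)

lemma norm_rot [simp]: "norm (rot l) = 1"
  unfolding norm_eq_1 rot_def by (simp add: inner_int_rot)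

lemma fst_inv_letter [simp]: "fst (inv_letter l) = fst l"
  by (cases l) simp

lemma gen_inv_letter: "gen (inv_letter l) = skew_inv (gen l)"
  by (simp add: gen_def qmul_linear_simps flip: qconj_rot)

lemma skew_comp_assoc: "skew_comp (skew_comp k l) m = skew_comp k (skew_comp l m)"
  by (cases k; cases l; cases m) (simp add: qmul_assoc qconj_mult qmul_linear_simps algebra_simps)

lemma skew_comp_one [simp]: "skew_comp (qone, 0) k = k"
  by (cases k) (simp add: qmul_linear_simps)

lemma norm_fst_gen [simp]: "norm (fst (gen l)) = 1"
  by (simp add: gen_def)

lemma norm_fst_motion [simp]: "norm (fst (motion w)) = 1"
proof (induction w)
  case (Cons l w)
  then show ?case by (cases "motion w") (simp add: gen_def norm_qmul)
qed simp

lemma motion_append: "motion (u @ v) = skew_comp (motion u) (motion v)"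
  by (induction u) (simp_all add: skew_comp_assoc)

lemma motion_cancel: "motion (u @ l # inv_letter l # v) = motion (u @ v)"
proof -
  have "motion (l # inv_letter l # v) = motion v"
    by (simp add: gen_inv_letter skew_comp_inv flip: skew_comp_assoc)
  then show ?thesis by (simp only: motion_append)
qed

definition lipschitz :: "(real^4) set" where
  "lipschitz = {x. x $ 1 \<in> \<int> \<and> x $ 2 \<in> \<int> \<and> x $ 3 \<in> \<int> \<and> x $ 4 \<in> \<int>}"

definition five_dvd :: "real^4 \<Rightarrow> bool" where
  "five_dvd x \<longleftrightarrow> (1 / 5) *\<^sub>R x \<in> lipschitz"

lemma lipschitz_closed:
  "x \<in> lipschitz \<Longrightarrow> y \<in> lipschitz \<Longrightarrow> x + y \<in> lipschitz"
  "x \<in> lipschitz \<Longrightarrow> y \<in> lipschitz \<Longrightarrow> x - y \<in> lipschitz"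
  "x \<in> lipschitz \<Longrightarrow> y \<in> lipschitz \<Longrightarrow> x \<star> y \<in> lipschitz"
  "c \<in> \<int> \<Longrightarrow> x \<in> lipschitz \<Longrightarrow> c *\<^sub>R x \<in> lipschitz"
  "x \<in> lipschitz \<Longrightarrow> qconj x \<in> lipschitz"
  by (auto simp: lipschitz_def qmul_def qconj_def intro!: Ints_add Ints_diff Ints_mult)

lemma qone_lipschitz: "qone \<in> lipschitz"
  by (simp add: lipschitz_def qone_def)

lemma int_rot_lipschitz: "int_rot l \<in> lipschitz"
  by (cases l rule: letter_cases) (simp_all add: lipschitz_def int_rot_def qone_def)

fun int_prod :: "letter list \<Rightarrow> real^4" where
  "int_prod [] = qone"
| "int_prod (l # w) = int_rot l \<star> int_prod w"

lemma int_prod_lipschitz: "int_prod w \<in> lipschitz"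
  by (induction w) (simp_all add: qone_lipschitz int_rot_lipschitz lipschitz_closed)

lemma fst_motion: "fst (motion w) = (1 / 5) ^ length w *\<^sub>R int_prod w"
proof (induction w)
  case (Cons l w)
  then show ?case by (cases "motion w") (simp add: gen_def rot_def qmul_linear_simps mult.commute)
qed simp

text \<open>A quaternion plus its conjugate is twice its real part; apply this to \<open>s \<star> t\<close> and multiply by \<open>s\<close> on the
  right.\<close>

lemma qmul_sandwich: "s \<star> t \<star> s = (2 * (s \<star> t) $ 1) *\<^sub>R s - (s \<bullet> s) *\<^sub>R qconj t"
  by (simp add: quat_simps algebra_simps)

text \<open>The squared norm of a letter is 25, hence modulo 5 \<open>s \<star> t \<star> s\<close> is congruent to twice the real part of \<open>s \<star> t\<close> times
  \<open>s\<close>. For letters \<open>s\<close> and \<open>t\<close> that are not inverse to each other the real part is 9 or -7, a unit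
  modulo 5. So if 5 divides \<open>t \<star> s \<star> x\<close>, then multiplication by \<open>s\<close> on the left shows that it
  divides \<open>s \<star> x\<close>. This is the step that keeps reduced products indivisible by 5.\<close>

lemma five_dvd_cancel_letter:
  assumes "five_dvd (int_rot l \<star> (int_rot m \<star> x))" "m \<noteq> inv_letter l" "x \<in> lipschitz"
  shows "five_dvd (int_rot m \<star> x)"
proof -
  let ?s = "int_rot m" and ?t = "int_rot l"
  define y where "y = (1 / 5) *\<^sub>R (?s \<star> x)"
  have y5: "5 *\<^sub>R y \<in> lipschitz"
    using assms(3) by (simp add: y_def int_rot_lipschitz lipschitz_closed)
  have "(1 / 5) *\<^sub>R (?t \<star> (?s \<star> x)) \<in> lipschitz" using assms(1) by (simp add: five_dvd_def)
  then have "?s \<star> ((1 / 5) *\<^sub>R (?t \<star> (?s \<star> x))) \<in> lipschitz"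
    by (rule lipschitz_closed(3)[OF int_rot_lipschitz])
  also have "?s \<star> ((1 / 5) *\<^sub>R (?t \<star> (?s \<star> x))) = (1 / 5) *\<^sub>R ((?s \<star> ?t \<star> ?s) \<star> x)"
    by (simp add: qmul_assoc qmul_linear_simps)
  also have "\<dots> = (2 * (?s \<star> ?t) $ 1) *\<^sub>R y - 5 *\<^sub>R (qconj ?t \<star> x)"
    unfolding qmul_sandwich inner_int_rot by (simp add: y_def qmul_linear_simps scaleR_diff_right)
  finally have "(2 * (?s \<star> ?t) $ 1) *\<^sub>R y - 5 *\<^sub>R (qconj ?t \<star> x) + 5 *\<^sub>R (qconj ?t \<star> x) \<in> lipschitz"
    by (rule lipschitz_closed(1)) (simp add: assms(3) int_rot_lipschitz lipschitz_closed)
  then have z: "(2 * (?s \<star> ?t) $ 1) *\<^sub>R y \<in> lipschitz" by simp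
  have "(?s \<star> ?t) $ 1 = 9 \<or> (?s \<star> ?t) $ 1 = - 7"
    using assms(2)
    by (cases l rule: letter_cases; cases m rule: letter_cases) (simp_all add: int_rot_def quat_simps)
  then have "y \<in> lipschitz"
  proof
    assume "(?s \<star> ?t) $ 1 = 9"
    then have h: "18 *\<^sub>R y \<in> lipschitz" using z by simp
    \<comment> \<open>18 is a unit modulo 5 with inverse 2, as \<open>2 * 18 - 7 * 5 = 1\<close>.\<close>
    have "2 *\<^sub>R 18 *\<^sub>R y - 7 *\<^sub>R 5 *\<^sub>R y \<in> lipschitz"
      by (rule lipschitz_closed(2)[OF lipschitz_closed(4)[OF _ h] lipschitz_closed(4)[OF _ y5]]) simp_all
    moreover have "2 *\<^sub>R 18 *\<^sub>R y - 7 *\<^sub>R 5 *\<^sub>R y = y" by (simp flip: scaleR_diff_left)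
    ultimately show ?thesis by simp
  next
    assume "(?s \<star> ?t) $ 1 = - 7"
    then have h: "(- 14) *\<^sub>R y \<in> lipschitz" using z by simp
    \<comment> \<open>-14 is congruent to 1, as \<open>- 14 + 3 * 5 = 1\<close>.\<close>
    have "(- 14) *\<^sub>R y + 3 *\<^sub>R 5 *\<^sub>R y \<in> lipschitz"
      by (rule lipschitz_closed(1)[OF h lipschitz_closed(4)[OF _ y5]]) simp
    moreover have "(- 14) *\<^sub>R y + 3 *\<^sub>R 5 *\<^sub>R y = y" by (simp flip: scaleR_diff_left)
    ultimately show ?thesis by simp
  qed
  then show ?thesis by (simp add: five_dvd_def y_def)
qed

abbreviation reduced :: "letter list \<Rightarrow> bool" where
  "reduced \<equiv> successively (\<lambda>l m. m \<noteq> inv_letter l)"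

lemma not_five_dvd_reduced: "reduced (l # w) \<Longrightarrow> \<not> five_dvd (int_prod (l # w))"
proof (induction w arbitrary: l)
  case Nil
  have "(int_rot l) $ 1 = 3"
    by (cases l rule: letter_cases) (simp_all add: int_rot_def quat_simps)
  moreover have "(3 / 5 :: real) \<notin> \<int>"
  proof
    assume "(3 / 5 :: real) \<in> \<int>"
    then obtain k where "3 / 5 = real_of_int k" by (auto elim: Ints_cases)
    then have "3 = real_of_int (5 * k)" by simp
    then have "3 = 5 * k" by linarith
    then show False by presburger
  qed
  ultimately show ?case by (simp add: five_dvd_def lipschitz_def)
next
  case (Cons m w)
  then show ?case
    using five_dvd_cancel_letter[of l m "int_prod w"] int_prod_lipschitz by auto
qed

lemma not_reduced_decomp:
  "\<not> reduced w \<Longrightarrow> \<exists>u l v. w = u @ l # inv_letter l # v"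
proof (induction w rule: induct_list012)
  case (3 l m w)
  show ?case
  proof (cases "m = inv_letter l")
    case True
    then show ?thesis by (metis append_Nil)
  next
    case False
    then have "\<not> reduced (m # w)" using 3 by simp
    then show ?thesis using 3 by (metis append_Cons)
  qed
qed simp_all

text \<open>If the rotation were trivial, the integral product would be a positive power of 5, contrary to
  the fact that 5 does not divide it.\<close>

lemma motion_reduced_neq_one:
  assumes "reduced w" "w \<noteq> []"
  shows "fst (motion w) \<noteq> qone"
proof
  assume 1: "fst (motion w) = qone"
  obtain l v where w: "w = l # v" using assms(2) by (cases w) auto
  have "int_prod w = (5 * 5 ^ length v) *\<^sub>R ((1 / 5) ^ length w *\<^sub>R int_prod w)"
    by (simp add: w power_divide)
  also have "\<dots> = (5 * 5 ^ length v) *\<^sub>R qone" using 1 by (simp add: fst_motion)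
  finally have "(1 / 5) *\<^sub>R int_prod w = 5 ^ length v *\<^sub>R qone" by simp
  then have "five_dvd (int_prod w)"
    unfolding five_dvd_def by (simp add: lipschitz_closed(4) qone_lipschitz)
  then show False using not_five_dvd_reduced assms(1) w by blast
qed

text \<open>By freeness a word with trivial rotation reduces to the empty word, and cancelling a letter against
  its inverse changes neither the rotation nor the cocycle. So the cocycle is a function of the
  rotation on this group.\<close>

lemma motion_trivial_rotation: "fst (motion w) = qone \<Longrightarrow> snd (motion w) = 0"
proof (induction w rule: length_induct)
  case (1 w)
  show ?case
  proof (cases "reduced w")
    case True
    then have "w = []" using motion_reduced_neq_one 1 by blast
    then show ?thesis by simp
  next
    case False
    then obtain u l v where w: "w = u @ l # inv_letter l # v" using not_reduced_decomp by blast
    then show ?thesis using 1 motion_cancel[of u l v] by auto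
  qed
qed

lemma skew_diffeo_motion_preserves_metric:
  "\<exists>m. riemannian_metric S3xS1 m \<and> preserves_metric S3xS1 (skew_diffeo (motion w)) m"
proof -
  obtain a t where at: "motion w = (a, t)" by (cases "motion w")
  have "\<exists>u. t = qconj a \<star> u - u"
  proof (cases "a = qone")
    case True
    then have "t = 0" using motion_trivial_rotation[of w] at by simp
    then show ?thesis using True by (intro exI[of _ 0]) (simp add: qmul_linear_simps)
  next
    case False
    then show ?thesis using unit_quat_coboundary by metis
  qed
  then show ?thesis using skew_coboundary_preserves_metric[of a] norm_fst_motion[of w] at by auto
qed

section \<open>Linear growth of the cocycle\<close>

text \<open>The origin lies in the interior of the convex hull of the translation parts of the six letters: for the
  letters of the axes \<open>i\<close>, \<open>j\<close>, \<open>k\<close> these are the negatives of \<open>1 \<plusminus> 2 i\<close>, \<open>i \<plusminus> 2 k\<close>, and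
  \<open>- 1 - i \<plusminus> 2 (j + k)\<close>, up to the factor \<open>2 / 5\<close>. Their sum is zero and they span. Consequently
  every nonzero vector makes with some letter an angle bounded away from a right angle.\<close>

lemma gen_positively_spans:
  "\<exists>l. y \<bullet> snd (gen l) \<ge> norm y / 22"
proof (rule ccontr)
  let ?\<eta> = "norm y / 22"
  assume "\<not> ?thesis"
  then have less: "y \<bullet> snd (gen l) < ?\<eta>" for l by (meson linorder_not_le)
  \<comment> \<open>The factor \<open>5 / 2\<close> removes the common factor \<open>2 / 5\<close> of the translation parts.\<close>
  define e where "e = 5 / 2 * ?\<eta>"
  have "- (y $ 1) - 2 * y $ 2 < e" "- (y $ 1) + 2 * y $ 2 < e"
    "- (y $ 2) + 2 * y $ 4 < e" "- (y $ 2) - 2 * y $ 4 < e"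
    "y $ 1 + y $ 2 + 2 * y $ 3 + 2 * y $ 4 < e" "y $ 1 + y $ 2 - 2 * y $ 3 - 2 * y $ 4 < e"
    using less[of "(Axis_i, True)"] less[of "(Axis_i, False)"] less[of "(Axis_j, True)"]
      less[of "(Axis_j, False)"] less[of "(Axis_k, True)"] less[of "(Axis_k, False)"]
    by (simp_all add: e_def gen_def rot_def int_rot_def quat_simps field_simps)
  then have "\<bar>y $ 1\<bar> + \<bar>y $ 2\<bar> + \<bar>y $ 3\<bar> + \<bar>y $ 4\<bar> < 17 / 2 * e" by linarith
  moreover have "norm y \<le> \<bar>y $ 1\<bar> + \<bar>y $ 2\<bar> + \<bar>y $ 3\<bar> + \<bar>y $ 4\<bar>"
    using norm_le_l1_cart[of y] by (simp add: sum_4)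
  ultimately show False using norm_ge_zero[of y] by (simp add: e_def)
qed

lemma gen_pushes_outward:
  "\<exists>l. norm (y + snd (gen l)) \<ge> norm y + 1 / 22"
proof (cases "y = 0")
  case True
  have "\<bar>snd (gen (Axis_i, True)) $ 1\<bar> \<le> norm (snd (gen (Axis_i, True)))" by (rule component_le_norm_cart)
  moreover have "snd (gen (Axis_i, True)) $ 1 = - (2 / 5)"
    by (simp add: gen_def rot_def int_rot_def quat_simps)
  ultimately show ?thesis using True by (intro exI[of _ "(Axis_i, True)"]) simp
next
  case False
  obtain l where l: "y \<bullet> snd (gen l) \<ge> norm y / 22" using gen_positively_spans by blast
  have "(norm y + 1 / 22) * norm y \<le> (y + snd (gen l)) \<bullet> y"
    using l by (simp add: inner_add_left inner_commute[of "snd (gen l)"] dot_square_norm power2_eq_square distrib_right)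
  also have "\<dots> \<le> norm (y + snd (gen l)) * norm y" by (rule norm_cauchy_schwarz)
  finally have "norm y + 1 / 22 \<le> norm (y + snd (gen l))" using False by simp
  then show ?thesis by blast
qed

text \<open>Prepending a letter to a word replaces \<open>t\<close>, up to an isometry, by \<open>a \<star> t\<close> plus the translation part of
  the letter. Choosing the letter that pushes \<open>a \<star> t\<close> outward increases the norm by a definite amount
  at every step, although along the powers of any one element the cocycle stays bounded.\<close>

lemma motion_linear_growth:
  "\<exists>w. length w = n \<and> norm (snd (motion w)) \<ge> real n / 22"
proof (induction n)
  case (Suc n)
  then obtain w where w: "length w = n" "norm (snd (motion w)) \<ge> real n / 22" by blast
  obtain a t where at: "motion w = (a, t)" by (cases "motion w")
  have a: "norm a = 1" using norm_fst_motion[of w] at by simp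
  obtain l where l: "norm (a \<star> t + snd (gen l)) \<ge> norm (a \<star> t) + 1 / 22"
    using gen_pushes_outward by blast
  have "snd (motion (l # w)) = t + qconj a \<star> snd (gen l)" by (simp add: at gen_def)
  also have "\<dots> = qconj a \<star> (a \<star> t + snd (gen l))" using a by (simp add: qmul_linear_simps)
  finally have "norm (snd (motion (l # w))) = norm (a \<star> t + snd (gen l))" using a by (simp add: norm_qmul)
  then have "norm (snd (motion (l # w))) \<ge> norm t + 1 / 22" using l a by (simp add: norm_qmul)
  then show ?case using w at by (intro exI[of _ "l # w"]) simp
qed simp

section \<open>Word length\<close>

definition group_word :: "('g, 'm) monoid_scheme \<Rightarrow> 'g set \<Rightarrow> 'g list \<Rightarrow> bool" where
  "group_word G S w \<longleftrightarrow> set w \<subseteq> S \<union> (\<lambda>s. inv\<^bsub>G\<^esub> s) ` S"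

definition word_prod :: "('g, 'm) monoid_scheme \<Rightarrow> 'g list \<Rightarrow> 'g" where
  "word_prod G w = foldr (\<lambda>s t. s \<otimes>\<^bsub>G\<^esub> t) w \<one>\<^bsub>G\<^esub>"

lemma word_length_alt:
  "word_length G S g = (LEAST n. \<exists>w. length w = n \<and> group_word G S w \<and> word_prod G w = g)"
  by (simp add: word_length_def group_word_def word_prod_def)

lemma word_prod_simps [simp]:
  "word_prod G [] = \<one>\<^bsub>G\<^esub>" "word_prod G (s # w) = s \<otimes>\<^bsub>G\<^esub> word_prod G w"
  by (simp_all add: word_prod_def)

context group
begin

lemma word_prod_closed: "S \<subseteq> carrier G \<Longrightarrow> group_word G S w \<Longrightarrow> word_prod G w \<in> carrier G"
  by (induction w) (auto simp: group_word_def)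

lemma word_prod_append:
  assumes "S \<subseteq> carrier G" "group_word G S u" "group_word G S v"
  shows "word_prod G (u @ v) = word_prod G u \<otimes> word_prod G v"
  using assms(2)
proof (induction u)
  case Nil
  then show ?case using word_prod_closed[OF assms(1,3)] by simp
next
  case (Cons s u)
  then have "s \<in> carrier G" "group_word G S u" using assms(1) by (auto simp: group_word_def)
  then show ?case using Cons word_prod_closed[OF assms(1)] assms(3) by (simp add: m_assoc)
qed

lemma generate_eq_word_prod:
  assumes "S \<subseteq> carrier G" "g \<in> generate G S"
  shows "\<exists>w. group_word G S w \<and> word_prod G w = g"
  using assms(2)
proof (induction rule: generate.induct)
  case one
  show ?case by (intro exI[of _ "[]"]) (simp add: group_word_def)
next
  case (incl h)
  then show ?case using assms(1) by (intro exI[of _ "[h]"]) (auto simp: group_word_def)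
next
  case (inv h)
  then show ?case using assms(1) by (intro exI[of _ "[inv h]"]) (auto simp: group_word_def)
next
  case (eng h1 h2)
  then obtain u v where uv: "group_word G S u" "word_prod G u = h1" "group_word G S v" "word_prod G v = h2"
    by blast
  then have "group_word G S (u @ v)" "word_prod G (u @ v) = h1 \<otimes> h2"
    using word_prod_append[OF assms(1)] by (auto simp: group_word_def)
  then show ?case by blast
qed

lemma word_length_witness:
  assumes "S \<subseteq> carrier G" "g \<in> generate G S"
  obtains w where "length w = word_length G S g" "group_word G S w" "word_prod G w = g"
proof -
  have "\<exists>n w. length w = n \<and> group_word G S w \<and> word_prod G w = g"
    using generate_eq_word_prod[OF assms] by blast
  from LeastI_ex[OF this] show thesis using that unfolding word_length_alt by blast
qed

lemma word_length_le: "group_word G S w \<Longrightarrow> word_length G S (word_prod G w) \<le> length w"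
  unfolding word_length_alt by (rule Least_le) blast

lemma word_length_one: "word_length G S \<one> = 0"
  using word_length_le[of S "[]"] by (simp add: group_word_def)

lemma word_length_mult_le:
  assumes "S \<subseteq> carrier G" "g \<in> generate G S" "h \<in> generate G S"
  shows "word_length G S (g \<otimes> h) \<le> word_length G S g + word_length G S h"
proof -
  obtain u where u: "length u = word_length G S g" "group_word G S u" "word_prod G u = g"
    using word_length_witness[OF assms(1,2)] .
  obtain v where v: "length v = word_length G S h" "group_word G S v" "word_prod G v = h"
    using word_length_witness[OF assms(1,3)] .
  have "group_word G S (u @ v)" using u(2) v(2) by (auto simp: group_word_def)
  from word_length_le[OF this] show ?thesis
    using u v word_prod_append[OF assms(1) u(2) v(2)] by simp
qed

end

section \<open>Invariant metrics bound all derivatives\<close>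

lemma tangent_map_norm_le_1:
  assumes "riemannian_metric M h" "preserves_metric M g h" "x \<in> M"
  shows "tangent_map_norm M h g x \<le> 1"
  unfolding tangent_map_norm_def
proof (rule SUP_least)
  fix v assume v: "v \<in> tangent_space M x - {0}"
  then have "h (g x) (tangent_map M g x v) (tangent_map M g x v) = h x v v"
    using assms(2,3) by (simp add: preserves_metric_def pullback_metric_def)
  moreover have "h x v v > 0" using assms(1,3) v unfolding riemannian_metric_def by blast
  ultimately show "ereal (metric_norm h (g x) (tangent_map M g x v) / metric_norm h x v) \<le> 1"
    by (simp add: metric_norm_def)
qed

text \<open>Every element and its inverse are isometries of the common metric, so all derivative norms in this
  metric are at most 1.\<close>

lemma subexponential_if_common_metric:
  assumes sub: "subgroup \<Gamma> (Diff M)" and h: "riemannian_metric M h" "\<forall>g\<in>\<Gamma>. preserves_metric M g h"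
  shows "subexponential_derivative_growth M h \<Gamma> S"
  unfolding subexponential_derivative_growth_def
proof (intro allI impI exI[of _ 1] ballI)
  fix \<epsilon> :: real and g assume \<epsilon>: "0 < \<epsilon>" and g: "g \<in> \<Gamma>"
  have gD: "g \<in> carrier (Diff M)" using subgroup.mem_carrier[OF sub g] .
  have "restrict (inv_into M g) M \<in> \<Gamma>"
    using subgroup.m_inv_closed[OF sub g] Diff_inv[OF gD] by simp
  then have "preserves_metric M (restrict (inv_into M g) M) h" using h(2) by blast
  then have inv: "preserves_metric M (inv_into M g) h"
    using tangent_map_cong[of M "restrict (inv_into M g) M" "inv_into M g"]
    by (simp add: preserves_metric_def pullback_metric_def)
  have "derivative_norm M h g \<le> 1"
    unfolding derivative_norm_def
    using tangent_map_norm_le_1[OF h(1) inv] tangent_map_norm_le_1[OF h(1), of g] h(2) g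
    by (intro SUP_least max.boundedI) simp_all
  also have "1 \<le> ereal (1 * exp (\<epsilon> * real (word_length (Diff M) S g)))" using \<epsilon> by simp
  finally show "derivative_norm M h g \<le> ereal (1 * exp (\<epsilon> * real (word_length (Diff M) S g)))" .
qed

section \<open>A group with exponential growth of derivatives\<close>

text \<open>The letters include the inverses of the three generators, so that every element of the group is given
  by a word.\<close>

definition letter_diffeos :: "((real^4) \<times> (real^2) \<Rightarrow> (real^4) \<times> (real^2)) set" where
  "letter_diffeos = range (\<lambda>l. skew_diffeo (gen l))"

definition skew_group :: "((real^4) \<times> (real^2) \<Rightarrow> (real^4) \<times> (real^2)) set" where
  "skew_group = generate (Diff S3xS1) letter_diffeos"

lemma finite_letter_diffeos: "finite letter_diffeos"
proof -
  have "(UNIV :: imag_axis set) = {Axis_i, Axis_j, Axis_k}" using imag_axis.exhaust by auto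
  then have "finite (UNIV :: imag_axis set)" by (metis finite.emptyI finite.insertI)
  then have "finite (UNIV :: letter set)" by (simp add: finite_prod)
  then show ?thesis by (simp add: letter_diffeos_def)
qed

lemma letter_diffeos_in_Diff: "letter_diffeos \<subseteq> carrier (Diff S3xS1)"
  by (auto simp: letter_diffeos_def skew_diffeo_in_Diff)

lemma skew_diffeo_motion_Nil: "skew_diffeo (motion []) = \<one>\<^bsub>Diff S3xS1\<^esub>"
  unfolding skew_diffeo_def Diff_simps(2) motion.simps(1) by (rule restrict_ext) (rule skew_id)

lemma skew_diffeo_motion_append:
  "skew_diffeo (motion (u @ v)) = skew_diffeo (motion u) \<otimes>\<^bsub>Diff S3xS1\<^esub> skew_diffeo (motion v)"
  by (simp add: motion_append skew_diffeo_comp)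

lemma skew_diffeo_motion_Cons:
  "skew_diffeo (motion (l # w)) = skew_diffeo (gen l) \<otimes>\<^bsub>Diff S3xS1\<^esub> skew_diffeo (motion w)"
  by (simp add: skew_diffeo_comp)

lemma skew_diffeo_gen: "skew_diffeo (gen l) = skew_diffeo (motion [l])"
  by (cases "gen l") (simp add: qmul_linear_simps)

lemma skew_diffeo_motion_in_skew_group: "skew_diffeo (motion w) \<in> skew_group"
proof (induction w)
  case Nil
  show ?case unfolding skew_diffeo_motion_Nil skew_group_def by (rule generate.one)
next
  case (Cons l w)
  have "skew_diffeo (gen l) \<in> skew_group"
    unfolding skew_group_def by (rule generate.incl) (simp add: letter_diffeos_def)
  then show ?case
    using Cons unfolding skew_diffeo_motion_Cons skew_group_def by (rule generate.eng)
qed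

lemma skew_diffeo_gen_inv_letter:
  "inv\<^bsub>Diff S3xS1\<^esub> skew_diffeo (gen l) = skew_diffeo (gen (inv_letter l))"
proof (rule group.inv_equality[OF group_Diff])
  have "skew_comp (gen (inv_letter l)) (gen l) = motion []"
    by (simp add: gen_inv_letter skew_comp_inv)
  then show "skew_diffeo (gen (inv_letter l)) \<otimes>\<^bsub>Diff S3xS1\<^esub> skew_diffeo (gen l) = \<one>\<^bsub>Diff S3xS1\<^esub>"
    by (simp only: skew_diffeo_comp norm_fst_gen skew_diffeo_motion_Nil)
qed (simp_all add: skew_diffeo_in_Diff)

lemma skew_group_is_motion: "g \<in> skew_group \<Longrightarrow> \<exists>w. g = skew_diffeo (motion w)"
  unfolding skew_group_def
proof (induction rule: generate.induct)
  case one
  show ?case using skew_diffeo_motion_Nil by metis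
next
  case (incl h)
  then obtain l where "h = skew_diffeo (gen l)" by (auto simp: letter_diffeos_def)
  then have "h = skew_diffeo (motion [l])" by (simp only: skew_diffeo_gen)
  then show ?case by blast
next
  case (inv h)
  then obtain l where "h = skew_diffeo (gen l)" by (auto simp: letter_diffeos_def)
  then have "inv\<^bsub>Diff S3xS1\<^esub> h = skew_diffeo (gen (inv_letter l))"
    by (simp only: skew_diffeo_gen_inv_letter)
  then have "inv\<^bsub>Diff S3xS1\<^esub> h = skew_diffeo (motion [inv_letter l])"
    by (simp only: skew_diffeo_gen)
  then show ?case by blast
next
  case (eng h1 h2)
  then show ?case using skew_diffeo_motion_append by metis
qed

text \<open>The length with respect to another finite generating set is at most the maximal length of a letter
  times the number of letters, so the choice of generators is immaterial.\<close>

lemma word_length_motion_linear: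
  assumes "finitely_generated_by (Diff S3xS1) skew_group S"
  obtains K where "\<And>w. word_length (Diff S3xS1) S (skew_diffeo (motion w)) \<le> K * length w"
proof -
  have S: "S \<subseteq> carrier (Diff S3xS1)" "generate (Diff S3xS1) S = skew_group"
    using assms by (simp_all add: finitely_generated_by_def)
  let ?wl = "word_length (Diff S3xS1) S"
  define K where "K = Max (?wl ` letter_diffeos)"
  have K: "?wl (skew_diffeo (gen l)) \<le> K" for l
    unfolding K_def
    by (rule Max_ge[OF finite_imageI[OF finite_letter_diffeos]]) (simp add: letter_diffeos_def)
  have "?wl (skew_diffeo (motion w)) \<le> K * length w" for w
  proof (induction w)
    case Nil
    show ?case by (simp only: skew_diffeo_motion_Nil group.word_length_one[OF group_Diff] le0)
  next
    case (Cons l w)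
    have "?wl (skew_diffeo (motion (l # w))) \<le> ?wl (skew_diffeo (gen l)) + ?wl (skew_diffeo (motion w))"
      unfolding skew_diffeo_motion_Cons
      by (rule group.word_length_mult_le[OF group_Diff S(1)])
        (simp_all only: S(2) skew_diffeo_gen skew_diffeo_motion_in_skew_group)
    then show ?case using K[of l] Cons by simp
  qed
  then show thesis using that by blast
qed

text \<open>Along the words of length \<open>n\<close> found above the derivative is at least a constant times \<open>e\<close> to the power
  \<open>n / 22\<close>, while their lengths in any other generators are at most proportional to \<open>n\<close>.\<close>

lemma exponential_derivative_growth_skew_group:
  "exponential_derivative_growth S3xS1 skew_group"
  unfolding exponential_derivative_growth_def
proof (intro allI impI notI)
  fix h S
  assume h: "riemannian_metric S3xS1 h" and S: "finitely_generated_by (Diff S3xS1) skew_group S"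
    and sub: "subexponential_derivative_growth S3xS1 h skew_group S"
  obtain K where K: "\<And>w. word_length (Diff S3xS1) S (skew_diffeo (motion w)) \<le> K * length w"
    using word_length_motion_linear[OF S] by blast
  obtain c where c: "c > 0"
    "\<And>a t. norm a = 1 \<Longrightarrow> ereal (c * exp (norm t)) \<le> derivative_norm S3xS1 h (skew_diffeo (a, t))"
    using derivative_norm_skew_lower_bound[OF h] by blast
  \<comment> \<open>With this \<open>\<epsilon>\<close> the allowed growth along the words found above is at most \<open>e\<close> to the
    power \<open>n / 44\<close>, which is half the exponent that they attain.\<close>
  define \<epsilon> where "\<epsilon> = 1 / 44 / (real K + 1)"
  have \<epsilon>: "\<epsilon> * (real K + 1) = 1 / 44" unfolding \<epsilon>_def by (rule nonzero_eq_divide_eq[THEN iffD1]) simp_all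
  have "\<epsilon> > 0" by (simp add: \<epsilon>_def add_nonneg_pos)
  from sub[unfolded subexponential_derivative_growth_def, rule_format, OF this]
  obtain C where C: "\<forall>g\<in>skew_group.
      derivative_norm S3xS1 h g \<le> ereal (C * exp (\<epsilon> * real (word_length (Diff S3xS1) S g)))"
    by blast
  have bound: "real n \<le> 44 * C / c" for n
  proof -
    obtain w where w: "length w = n" "norm (snd (motion w)) \<ge> real n / 22"
      using motion_linear_growth by blast
    obtain a t where at: "motion w = (a, t)" by (cases "motion w")
    let ?g = "skew_diffeo (motion w)"
    let ?L = "real (word_length (Diff S3xS1) S ?g)"
    have "norm a = 1" using norm_fst_motion[of w] at by simp
    then have "ereal (c * exp (norm t)) \<le> derivative_norm S3xS1 h ?g" using c(2) at by simp
    also have "\<dots> \<le> ereal (C * exp (\<epsilon> * ?L))" using C skew_diffeo_motion_in_skew_group by blast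
    finally have le: "c * exp (norm t) \<le> C * exp (\<epsilon> * ?L)" by simp
    have "0 < c * exp (norm t)" using c(1) by simp
    then have "0 < C * exp (\<epsilon> * ?L)" using le by linarith
    then have "C > 0" by (simp add: zero_less_mult_iff)
    have "?L \<le> real K * real n" using K[of w] w(1) by (metis of_nat_le_iff of_nat_mult)
    then have "\<epsilon> * ?L \<le> \<epsilon> * (real K * real n)" using \<open>\<epsilon> > 0\<close> by simp
    also have "\<dots> \<le> \<epsilon> * ((real K + 1) * real n)" using \<open>\<epsilon> > 0\<close> by (simp add: mult_right_mono)
    also have "\<dots> = real n / 44" by (simp only: \<epsilon> flip: mult.assoc)
    finally have "C * exp (\<epsilon> * ?L) \<le> C * exp (real n / 44)" using \<open>C > 0\<close> by simp
    moreover have "c * exp (real n / 22) \<le> c * exp (norm t)" using w(2) at c(1) by simp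
    ultimately have "c * exp (real n / 22) \<le> C * exp (real n / 44)" using le by linarith
    moreover have "exp (real n / 22) = exp (real n / 44) * exp (real n / 44)" by (simp flip: exp_add)
    ultimately have "(c * exp (real n / 44)) * exp (real n / 44) \<le> C * exp (real n / 44)" by (simp add: mult.assoc)
    then have "c * exp (real n / 44) \<le> C" by simp
    moreover have "c * (real n / 44) \<le> c * exp (real n / 44)"
    proof (rule mult_left_mono)
      show "real n / 44 \<le> exp (real n / 44)" using exp_ge_add_one_self[of "real n / 44"] by linarith
    qed (use c(1) in simp)
    ultimately have "c * (real n / 44) \<le> C" by linarith
    then show ?thesis using c(1) by (simp add: field_simps)
  qed
  obtain n where "44 * C / c < real n" using reals_Archimedean2 by blast
  then show False using bound[of n] by linarith
qed

theorem theorem1p5: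
  shows "\<exists>\<Gamma>. subgroup \<Gamma> (Diff S3xS1) \<and>
    (\<exists>S. finitely_generated_by (Diff S3xS1) \<Gamma> S) \<and>
    exponential_derivative_growth S3xS1 \<Gamma> \<and>
    (\<forall>g\<in>\<Gamma>. \<exists>m. riemannian_metric S3xS1 m \<and> preserves_metric S3xS1 g m) \<and>
    \<not> (\<exists>m. riemannian_metric S3xS1 m \<and> (\<forall>g\<in>\<Gamma>. preserves_metric S3xS1 g m))"
proof (rule exI[of _ skew_group], intro conjI)
  show sub: "subgroup skew_group (Diff S3xS1)"
    unfolding skew_group_def by (rule group.generate_is_subgroup[OF group_Diff letter_diffeos_in_Diff])
  have gen: "finitely_generated_by (Diff S3xS1) skew_group letter_diffeos"
    by (simp add: finitely_generated_by_def finite_letter_diffeos letter_diffeos_in_Diff skew_group_def)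
  then show "\<exists>S. finitely_generated_by (Diff S3xS1) skew_group S" by blast
  show exp: "exponential_derivative_growth S3xS1 skew_group"
    by (rule exponential_derivative_growth_skew_group)
  show "\<forall>g\<in>skew_group. \<exists>m. riemannian_metric S3xS1 m \<and> preserves_metric S3xS1 g m"
    using skew_group_is_motion skew_diffeo_motion_preserves_metric by blast
  show "\<not> (\<exists>m. riemannian_metric S3xS1 m \<and> (\<forall>g\<in>skew_group. preserves_metric S3xS1 g m))"
    using subexponential_if_common_metric[OF sub] exp gen unfolding exponential_derivative_growth_def by blast
qed

end
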